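(* Let $X$ be a compact metric space with compatible metric $d$, let $T\colon X\to X$ be a homeomorphism, and let $\mathscr{C}$ be a characteristic class. Let $$\operatorname{Gen}(\mathscr{C})=\big\{x\in X : x\in\operatorname{Gen}(\mu)\text{ for some }\mu\in\mathcal{M}_T(X)\text{ with }(X,\mu,T)\in\mathscr{C}\big\}.$$ Then $\operatorname{Gen}(\mathscr{C})$ is closed with respect to the Besicovitch pseudometric $D_B$; that is, if $(x_m)_{m=1}^{\infty}\subseteq\operatorname{Gen}(\mathscr{C})$ and $x\in X$ satisfy $D_B(x_m,x)\to 0$ as $m\to\infty$, then $x\in\operatorname{Gen}(\mathscr{C})$.
   Context: $\mathcal{M}_T(X)$ denotes the set of $T$-invariant Borel probability measures on $X$. All measure-preserving systems are of the form $(X,\mu,T)$, where $X$ is a compact metric space equipped with its Borel $\sigma$-algebra, $T\colon X\to X$ is a homeomorphism, and $\mu\in\mathcal{M}_T(X)$. A point $x\in X$ is generic for $\mu\in\mathcal{M}_T(X)$ if $\frac1n\sum_{j=0}^{n-1}f(T^j(x))\to\int f\,d\mu$ as $n\to\infty$ for every continuous function $f$ on $X$. The set of all generic points for $\mu$ is denoted by $\operatorname{Gen}(\mu)$. The Besicovitch pseudometric on $X$ is $$D_B(x,y)=\limsup_{n\to\infty}\frac1n\sum_{j=0}^{n-1}d(T^j(x),T^j(y)).$$ A system $(Y,\nu,S)$ is a factor of $(X,\mu,T)$ if there is a measurable map $\pi\colon X\to Y$ with $\pi\circ T=S\circ\pi$ such that the push-forward of $\mu$ under $\pi$ is $\nu$.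 For an at most countable family of measure-preserving systems $(X_i,\mu_i,T_i)_{i\in I}$, a joining of $(\mu_i)_{i\in I}$ is a probability measure on $\prod_{i\in I}X_i$ that is invariant under $\prod_{i\in I}T_i$ and whose marginal on $X_i$ is $\mu_i$ for every $i\in I$. A characteristic class is a collection $\mathscr{C}$ of measure-preserving systems that is closed under taking factors and (at most countable) joinings; closure under joinings means that if $(X_i,\mu_i,T_i)\in\mathscr{C}$ for all $i\in I$ with $I$ at most countable and $\lambda$ is a joining of $(\mu_i)_{i\in I}$, then $(\prod_{i\in I}X_i,\lambda,\prod_{i\in I}T_i)\in\mathscr{C}$. *)

theory Defs
  imports "HOL-Analysis.Analysis" "HOL-Probability.Probability_Measure"
begin

definition borel_of :: "'a topology \<Rightarrow> 'a measure" where
  "borel_of X = sigma (topspace X) {U. openin X U}"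

definition invariant_measures :: "'a topology \<Rightarrow> ('a \<Rightarrow> 'a) \<Rightarrow> 'a measure set" where
  "invariant_measures X T =
     {\<mu>. sets \<mu> = sets (borel_of X) \<and> prob_space \<mu> \<and> distr \<mu> \<mu> T = \<mu>}"

text \<open>Spaces are topologies with an explicit carrier, and the values of the maps outside the
  carrier are irrelevant. Only the topology of a compact metric space enters into a system.\<close>

type_synonym 'a system = "'a topology \<times> 'a measure \<times> ('a \<Rightarrow> 'a)"

definition mp_system :: "'a topology \<Rightarrow> 'a measure \<Rightarrow> ('a \<Rightarrow> 'a) \<Rightarrow> bool" where
  "mp_system X \<mu> T \<longleftrightarrow>
     compact_space X \<and> metrizable_space X \<and> homeomorphic_map X X T \<and>
     \<mu> \<in> invariant_measures X T"

definition generic_points :: "'a topology \<Rightarrow> ('a \<Rightarrow> 'a) \<Rightarrow> 'a measure \<Rightarrow> 'a set" where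
  "generic_points X T \<mu> =
     {x \<in> topspace X. \<forall>f. continuous_map X euclideanreal f \<longrightarrow>
        (\<lambda>n. (\<Sum>j<n. f ((T ^^ j) x)) / real n) \<longlonglongrightarrow> (\<integral>y. f y \<partial>\<mu>)}"

definition besicovitch :: "('a \<Rightarrow> 'a \<Rightarrow> real) \<Rightarrow> ('a \<Rightarrow> 'a) \<Rightarrow> 'a \<Rightarrow> 'a \<Rightarrow> ereal" where
  "besicovitch d T x y =
     limsup (\<lambda>n. ereal ((\<Sum>j<n. d ((T ^^ j) x) ((T ^^ j) y)) / real n))"

text \<open>\<open>is_factor Y \<nu> S X \<mu> T\<close>: the system \<open>(Y, \<nu>, S)\<close> is a factor of \<open>(X, \<mu>, T)\<close>.
  The intertwining relation is required at every point, not only almost everywhere.\<close>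

definition is_factor ::
  "'b topology \<Rightarrow> 'b measure \<Rightarrow> ('b \<Rightarrow> 'b) \<Rightarrow> 'a topology \<Rightarrow> 'a measure \<Rightarrow> ('a \<Rightarrow> 'a) \<Rightarrow> bool"
where
  "is_factor Y \<nu> S X \<mu> T \<longleftrightarrow>
     (\<exists>\<pi> \<in> measurable (borel_of X) (borel_of Y).
        (\<forall>x \<in> topspace X. \<pi> (T x) = S (\<pi> x)) \<and> distr \<mu> (borel_of Y) \<pi> = \<nu>)"

definition prod_map :: "'i set \<Rightarrow> ('i \<Rightarrow> 'a \<Rightarrow> 'a) \<Rightarrow> ('i \<Rightarrow> 'a) \<Rightarrow> ('i \<Rightarrow> 'a)" where
  "prod_map I T = (\<lambda>x. \<lambda>i\<in>I. T i (x i))"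

definition is_joining ::
  "'i set \<Rightarrow> ('i \<Rightarrow> 'a topology) \<Rightarrow> ('i \<Rightarrow> 'a measure) \<Rightarrow> ('i \<Rightarrow> 'a \<Rightarrow> 'a) \<Rightarrow>
   ('i \<Rightarrow> 'a) measure \<Rightarrow> bool"
where
  "is_joining I X \<mu> T \<rho> \<longleftrightarrow>
     \<rho> \<in> invariant_measures (product_topology X I) (prod_map I T) \<and>
     (\<forall>i\<in>I. distr \<rho> (borel_of (X i)) (\<lambda>x. x i) = \<mu> i)"

text \<open>A collection of systems can only contain systems whose points come from one fixed type
  \<open>'u\<close>, whereas a product of such systems, or a given space, has points of another type. So a
  system with points of any type is said to belong to the collection if the collection contains
  a homeomorphic copy of it. Since the collections of interest are closed under factors, and
  hence under isomorphism, the choice of the copy is irrelevant. A compact metric space has at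
  most continuum many points, so if \<open>'u\<close> has at least that many elements (\<open>real\<close>, say), then
  every system has a copy with points in \<open>'u\<close> and nothing is lost.\<close>

definition belongs ::
  "'u system set \<Rightarrow> 'a topology \<Rightarrow> 'a measure \<Rightarrow> ('a \<Rightarrow> 'a) \<Rightarrow> bool"
where
  "belongs \<C> X \<mu> T \<longleftrightarrow>
     (\<exists>Y \<nu> S h. (Y, \<nu>, S) \<in> \<C> \<and> homeomorphic_map X Y h \<and>
        (\<forall>x \<in> topspace X. h (T x) = S (h x)) \<and> distr \<mu> (borel_of Y) h = \<nu>)"

text \<open>An at most countable family may be indexed by a subset of \<open>nat\<close>.\<close>

definition characteristic_class :: "'u system set \<Rightarrow> bool" where
  "characteristic_class \<C> \<longleftrightarrow>
     (\<forall>X \<mu> T. (X, \<mu>, T) \<in> \<C> \<longrightarrow> mp_system X \<mu> T) \<and>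
     (\<forall>X \<mu> T Y \<nu> S. (X, \<mu>, T) \<in> \<C> \<and> mp_system Y \<nu> S \<and> is_factor Y \<nu> S X \<mu> T \<longrightarrow>
        (Y, \<nu>, S) \<in> \<C>) \<and>
     (\<forall>(I :: nat set) X \<mu> T \<rho>. (\<forall>i\<in>I. (X i, \<mu> i, T i) \<in> \<C>) \<and> is_joining I X \<mu> T \<rho> \<longrightarrow>
        belongs \<C> (product_topology X I) \<rho> (prod_map I T))"

definition class_generic_points ::
  "'a topology \<Rightarrow> ('a \<Rightarrow> 'a) \<Rightarrow> 'u system set \<Rightarrow> 'a set"
where
  "class_generic_points X T \<C> =
     {x \<in> topspace X. \<exists>\<mu> \<in> invariant_measures X T. belongs \<C> X \<mu> T \<and> x \<in> generic_points X T \<mu>}"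

end

theory Submission
  imports Defs "HOL-Probability.Probability"
begin

text \<open>After passing to a subsequence, $D_B(x_m, x) < 2^{-m}$. Along suitable times the empirical
  measures of the point $(x_m)_m$ of the countable power of $X$ converge to a joining $\rho$ of
  the measures $\mu_m$, and $\int d(y_m, y_{m+1})\,d\rho(y) \le 2 \cdot 2^{-m}$. Hence $\rho$-almost
  every sequence $y$ converges, and $y \mapsto \lim_m y_m$ exhibits the law of the limit as a factor
  of the joining. The averages of a continuous function along $x$ converge to its integral against
  this law, because both are limits of the integrals against $\mu_m$.\<close>

subsection \<open>Borel measures on metrizable topologies\<close>

text \<open>Only the measures \<mu>_m are joined, because \<open>x\<close> is not yet known to be
  generic for anything. The point \<open>x\<close> enters as the intermediate point of the triangle
  inequality between two consecutive orbits, which bounds their mean distance by 2^{-m} + 2^{-(m+1)}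
  \<le> 2 * 2^{-m}. The geometric rate makes these bounds summable, and this turns closeness in mean
  into almost sure convergence: a factor needs a map defined on points, and weak convergence of the
  \<mu>_m alone would not provide one. Limits of empirical measures are obtained on the real line,
  where tightness gives convergent subsequences, and come back to the compact space through a coding
  whose inverse is continuous. Two features of the definitions shape the rest. A factor map has to
  commute with the dynamics at every point, also where the sequence diverges. A class contains
  systems over one fixed type of points only, so the argument runs on a homeomorphic copy of X that
  occurs in the class, and its outcome is transported back.\<close>

lemma space_borel_of [simp]: "space (borel_of X) = topspace X"
  unfolding borel_of_def by (rule space_measure_of) (auto dest: openin_subset)

lemma sets_borel_of: "sets (borel_of X) = sigma_sets (topspace X) {U. openin X U}"
  unfolding borel_of_def by (rule sets_measure_of) (auto dest: openin_subset)

lemma borel_of_openin: "openin X U \<Longrightarrow> U \<in> sets (borel_of X)"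
  by (auto simp: sets_borel_of)

lemma borel_of_closedin: "closedin X C \<Longrightarrow> C \<in> sets (borel_of X)"
  using sets.compl_sets[OF borel_of_openin[of X "topspace X - C"]]
  by (auto simp: closedin_def double_diff)

text \<open>Closed sets serve as generators because they are stable under intersection and, in a
  metrizable space, their indicators are pointwise limits of continuous functions.\<close>

lemma sets_borel_of_closedin:
  "sets (borel_of X) = sigma_sets (topspace X) {C. closedin X C}"
proof
  show "sets (borel_of X) \<subseteq> sigma_sets (topspace X) {C. closedin X C}"
    unfolding sets_borel_of
  proof (rule sigma_sets_mono, safe)
    fix U assume "openin X U"
    then have "topspace X - (topspace X - U) \<in> sigma_sets (topspace X) {C. closedin X C}"
      by (intro sigma_sets.Compl sigma_sets.Basic) auto
    moreover have "topspace X - (topspace X - U) = U"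
      using \<open>openin X U\<close> openin_subset by blast
    ultimately show "U \<in> sigma_sets (topspace X) {C. closedin X C}"
      by simp
  qed
  show "sigma_sets (topspace X) {C. closedin X C} \<subseteq> sets (borel_of X)"
    using sets.sigma_sets_subset[of "{C. closedin X C}" "borel_of X"]
    by (auto intro: borel_of_closedin)
qed

lemma borel_of_euclidean: "borel_of euclidean = borel"
  unfolding borel_of_def borel_def by simp

lemma measurable_continuous_map:
  assumes "continuous_map X Y f"
  shows "f \<in> measurable (borel_of X) (borel_of Y)"
proof (subst (2) borel_of_def, rule measurable_measure_of)
  show "f \<in> space (borel_of X) \<rightarrow> topspace Y"
    using continuous_map_funspace[OF assms] by simp
  fix U assume "U \<in> {U. openin Y U}"
  then have "openin X {x \<in> topspace X. f x \<in> U}"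
    using assms by (auto simp: continuous_map_def)
  moreover have "f -` U \<inter> space (borel_of X) = {x \<in> topspace X. f x \<in> U}"
    by auto
  ultimately show "f -` U \<inter> space (borel_of X) \<in> sets (borel_of X)"
    by (simp add: borel_of_openin)
qed (auto dest: openin_subset)

lemma borel_measurable_continuous_map:
  fixes f :: "'a \<Rightarrow> 'b::topological_space"
  assumes "continuous_map X euclidean f"
  shows "f \<in> borel_measurable (borel_of X)"
  using measurable_continuous_map[OF assms] by (simp add: borel_of_euclidean)

text \<open>A closed set is a decreasing intersection of open sets \<open>U n\<close>; take Urysohn
  functions that are 1 on \<open>C\<close> and 0 off \<open>U n\<close>. Since the sets decrease, a
  point outside \<open>C\<close> is eventually outside every \<open>U n\<close>, so its values are
  eventually 0.\<close>

lemma closedin_indicator_limit: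
  assumes "metrizable_space X" "closedin X C"
  obtains g :: "nat \<Rightarrow> 'a \<Rightarrow> real" where
    "\<And>n. continuous_map X euclideanreal (g n)"
    "\<And>n x. x \<in> topspace X \<Longrightarrow> \<bar>g n x\<bar> \<le> 1"
    "\<And>x. x \<in> topspace X \<Longrightarrow> (\<lambda>n. g n x) \<longlonglongrightarrow> indicator C x"
proof -
  obtain U where U: "\<And>n. openin X (U n)" "\<And>n. U (Suc n) \<subseteq> U n" "\<Inter>(range U) = C"
    using closed_imp_gdelta_in[OF assms] unfolding gdelta_in_descending by metis
  have mono: "U n \<subseteq> U m" if "m \<le> n" for m n
    using lift_Suc_antimono_le[of U, OF U(2) that] .
  have "\<exists>f. continuous_map X (subtopology euclideanreal {0..1}) f \<and>
            f ` (topspace X - U n) \<subseteq> {0} \<and> f ` C \<subseteq> {1}" for n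
  proof -
    have "disjnt (topspace X - U n) C"
      using U(3) by (auto simp: disjnt_def)
    then show ?thesis
      using Urysohn_lemma[OF metrizable_imp_normal_space[OF assms(1)], of "topspace X - U n" C 0 1]
        assms(2) U(1) by (metis closedin_diff closedin_topspace zero_le_one)
  qed
  then obtain g where g: "\<And>n. continuous_map X (subtopology euclideanreal {0..1}) (g n)"
    and g0: "\<And>n. g n ` (topspace X - U n) \<subseteq> {0}" and g1: "\<And>n. g n ` C \<subseteq> {1::real}"
    by metis
  show ?thesis
  proof
    show "continuous_map X euclideanreal (g n)" for n
      using g[of n] by (simp add: continuous_map_in_subtopology)
    show "\<bar>g n x\<bar> \<le> 1" if "x \<in> topspace X" for n x
    proof -
      have "g n x \<in> {0..1}"
        using g[of n] that by (auto simp: continuous_map_in_subtopology)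
      then show ?thesis by simp
    qed
    show "(\<lambda>n. g n x) \<longlonglongrightarrow> indicator C x" if x: "x \<in> topspace X" for x
    proof (cases "x \<in> C")
      case True
      then have "g n x = 1" for n using g1[of n] by auto
      with True show ?thesis by simp
    next
      case False
      then obtain N where "x \<notin> U N" using U(3) by auto
      then have "\<And>n. n \<ge> N \<Longrightarrow> x \<notin> U n" using mono by blast
      then have "\<And>n. n \<ge> N \<Longrightarrow> g n x = 0" using g0 x by fastforce
      then have "eventually (\<lambda>n. g n x = 0) sequentially"
        by (auto simp: eventually_sequentially)
      with False show ?thesis by (simp add: tendsto_eventually)
    qed
  qed
qed

lemma continuous_map_bounded_on_compact:
  assumes "compact_space X" "continuous_map X euclideanreal f"
  obtains B where "B > 0" "\<And>x. x \<in> topspace X \<Longrightarrow> \<bar>f x\<bar> \<le> B"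
proof -
  have "compact (f ` topspace X)"
    using image_compactin[OF _ assms(2), of "topspace X"] assms(1)
    by (simp add: compact_space_def)
  then obtain B where "\<And>x. x \<in> topspace X \<Longrightarrow> \<bar>f x\<bar> \<le> B"
    using compact_imp_bounded bounded_iff by (metis image_eqI real_norm_def)
  then show ?thesis
    by (intro that[of "max B 1"]) (auto simp: le_max_iff_disj)
qed

text \<open>Composition with \<open>F\<close> turns the approximation of the indicator of a closed
  set into a limit of measurable real functions. Measurability of maps that are not continuous, such
  as the limit of a sequence, is thereby reduced to real-valued functions.\<close>

lemma measurable_borel_ofI:
  assumes X: "metrizable_space X" and F: "F \<in> space M \<rightarrow> topspace X"
    and meas: "\<And>f. continuous_map X euclideanreal f \<Longrightarrow> (\<lambda>x. f (F x)) \<in> borel_measurable M"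
  shows "F \<in> measurable M (borel_of X)"
proof (rule measurable_sigma_sets[OF sets_borel_of_closedin _ F])
  fix C assume "C \<in> {C. closedin X C}"
  then obtain g where g: "\<And>n::nat. continuous_map X euclideanreal (g n)"
    "\<And>x. x \<in> topspace X \<Longrightarrow> (\<lambda>n. g n x) \<longlonglongrightarrow> indicator C x"
    using closedin_indicator_limit[OF X] by (metis mem_Collect_eq)
  have "(\<lambda>x. indicator C (F x) :: real) \<in> borel_measurable M"
    by (rule borel_measurable_LIMSEQ_real[OF g(2) meas[OF g(1)]]) (use F in auto)
  then have "{x \<in> space M. indicator C (F x) = (1::real)} \<in> sets M"
    by measurable
  moreover have "{x \<in> space M. indicator C (F x) = (1::real)} = F -` C \<inter> space M"
    by (auto simp: indicator_def split: if_splits)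
  ultimately show "F -` C \<inter> space M \<in> sets M" by simp
qed (auto dest: closedin_subset)

text \<open>By dominated convergence, the integrals of continuous functions determine the measure of
  every closed set. Invariance and marginals of a weak limit are identified in this way.\<close>

lemma measure_eqI_continuous_map:
  assumes X: "metrizable_space X" and \<mu>: "prob_space \<mu>" "sets \<mu> = sets (borel_of X)"
    and \<nu>: "prob_space \<nu>" "sets \<nu> = sets (borel_of X)"
    and eq: "\<And>f. continuous_map X euclideanreal f \<Longrightarrow> (\<integral>x. f x \<partial>\<mu>) = (\<integral>x. f x \<partial>\<nu>)"
  shows "\<mu> = \<nu>"
proof (rule measure_eqI_generator_eq_countable[where E="{C. closedin X C}" and \<Omega>="topspace X"
      and A="{topspace X}"])
  interpret \<mu>: prob_space \<mu> by fact
  interpret \<nu>: prob_space \<nu> by fact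
  have sp: "space \<mu> = topspace X" "space \<nu> = topspace X"
    using sets_eq_imp_space_eq[OF \<mu>(2)] sets_eq_imp_space_eq[OF \<nu>(2)] by simp_all
  fix C assume "C \<in> {C. closedin X C}"
  then have C: "closedin X C" by simp
  then obtain g where g: "\<And>n::nat. continuous_map X euclideanreal (g n)"
    "\<And>n x. x \<in> topspace X \<Longrightarrow> \<bar>g n x\<bar> \<le> 1"
    "\<And>x. x \<in> topspace X \<Longrightarrow> (\<lambda>n. g n x) \<longlonglongrightarrow> indicator C x"
    using closedin_indicator_limit[OF X] by metis
  have lim: "(\<lambda>n. \<integral>x. g n x \<partial>M) \<longlonglongrightarrow> measure M C"
    if M: "prob_space M" "sets M = sets (borel_of X)" for M
  proof -
    interpret prob_space M by fact
    have spM: "space M = topspace X" using sets_eq_imp_space_eq[OF M(2)] by simp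
    have gm: "g n \<in> borel_measurable M" for n
      using borel_measurable_continuous_map[OF g(1)] by (simp add: measurable_cong_sets[OF M(2) refl])
    have Cm: "C \<in> sets M" using borel_of_closedin[OF C] M(2) by simp
    have "(\<lambda>n. \<integral>x. g n x \<partial>M) \<longlonglongrightarrow> (\<integral>x. indicator C x \<partial>M)"
      by (rule integral_dominated_convergence[where w="\<lambda>_. 1"])
        (use gm Cm g(2,3) spM in auto)
    then show ?thesis using Cm by (simp add: Int_absorb2 sets.sets_into_space)
  qed
  have "measure \<mu> C = measure \<nu> C"
    using LIMSEQ_unique[OF lim[OF \<mu>]] lim[OF \<nu>] eq[OF g(1)] by simp
  then show "emeasure \<mu> C = emeasure \<nu> C"
    by (simp add: \<mu>.emeasure_eq_measure \<nu>.emeasure_eq_measure)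
next
  show "Int_stable {C. closedin X C}"
    by (auto simp: Int_stable_def)
  show "\<And>a. a \<in> {topspace X} \<Longrightarrow> emeasure \<mu> a \<noteq> \<infinity>"
    using prob_space.finite_measure[OF \<mu>(1)] finite_measure.emeasure_finite by auto
qed (use \<mu> \<nu> in \<open>auto simp: sets_borel_of_closedin dest: closedin_subset\<close>)

subsection \<open>Weak limits of empirical measures\<close>

lemma ternary_expansion_summable:
  fixes b :: "nat \<Rightarrow> real"
  assumes "\<And>n. \<bar>b n\<bar> \<le> 1"
  shows "summable (\<lambda>n. b n / 3 ^ n)"
proof (rule summable_comparison_test')
  show "summable (\<lambda>n. (1/3::real) ^ n)"
    by (simp add: summable_geometric)
  show "norm (b n / 3 ^ n) \<le> (1/3) ^ n" if "n \<ge> 0" for n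
    using assms[of n] by (simp add: power_divide divide_right_mono)
qed

text \<open>The digits may be any reals of absolute value at most 1, because the bound is applied to
  the digitwise difference of two 0/1 expansions.\<close>

lemma ternary_expansion_bound:
  fixes b :: "nat \<Rightarrow> real"
  assumes "\<And>n. \<bar>b n\<bar> \<le> 1"
  shows "\<bar>\<Sum>n. b n / 3 ^ n\<bar> \<le> 3 / 2"
proof -
  have g: "(\<lambda>n. (1/3::real) ^ n) sums (1 / (1 - 1/3))"
    by (rule geometric_sums) simp
  have "norm (\<Sum>n. b n / 3 ^ n) \<le> (\<Sum>n. (1/3) ^ n)"
    using assms by (intro norm_suminf_le sums_summable[OF g])
      (simp add: power_divide divide_right_mono)
  with sums_unique[OF g] show ?thesis by simp
qed

text \<open>The first differing digit, at position \<open>k\<close>, contributes 3^{-k}, and all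
  later ones together at most (3/2) / 3^{k+1} = 1 / (2 * 3^k), so they cannot cancel it. In base 2
  the tail could cancel the leading difference; this is the reason for base 3.\<close>

lemma ternary_expansion_inj:
  fixes b c :: "nat \<Rightarrow> real"
  assumes b: "\<And>n. b n \<in> {0, 1}" and c: "\<And>n. c n \<in> {0, 1}"
    and close: "\<bar>(\<Sum>n. b n / 3 ^ n) - (\<Sum>n. c n / 3 ^ n)\<bar> < 1 / (2 * 3 ^ N)" and "n \<le> N"
  shows "b n = c n"
proof (rule ccontr)
  assume "b n \<noteq> c n"
  define k where "k = (LEAST n. b n \<noteq> c n)"
  have k: "b k \<noteq> c k" unfolding k_def by (rule LeastI) fact
  have "k \<le> n" unfolding k_def by (rule Least_le) fact
  have less: "b i = c i" if "i < k" for i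
    using not_less_Least[of i "\<lambda>n. b n \<noteq> c n"] that by (auto simp: k_def)
  define a where "a i = b i - c i" for i
  have a: "\<bar>a i\<bar> \<le> 1" for i using b[of i] c[of i] by (auto simp: a_def)
  have ak: "\<bar>a k\<bar> = 1" using k b[of k] c[of k] by (auto simp: a_def)
  have "\<bar>b i\<bar> \<le> 1" "\<bar>c i\<bar> \<le> 1" for i
    using b[of i] c[of i] by auto
  note sb = this[THEN ternary_expansion_summable]
  have "(\<Sum>n. b n / 3 ^ n) - (\<Sum>n. c n / 3 ^ n) = (\<Sum>n. a n / 3 ^ n)"
    unfolding a_def by (simp add: suminf_diff[OF sb] diff_divide_distrib)
  also have "\<dots> = (\<Sum>n. a (n + Suc k) / 3 ^ (n + Suc k)) + (\<Sum>i<Suc k. a i / 3 ^ i)"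
    by (rule suminf_split_initial_segment[OF ternary_expansion_summable[OF a]])
  also have "(\<Sum>i<Suc k. a i / 3 ^ i) = a k / 3 ^ k"
    using less by (simp add: a_def)
  also have "(\<Sum>n. a (n + Suc k) / 3 ^ (n + Suc k)) = (\<Sum>n. a (n + Suc k) / 3 ^ n) / 3 ^ Suc k"
    by (subst suminf_divide[symmetric])
      (use ternary_expansion_summable[of "\<lambda>n. a (n + Suc k)"] a in \<open>auto simp: power_add field_simps\<close>)
  finally have eq: "(\<Sum>n. b n / 3 ^ n) - (\<Sum>n. c n / 3 ^ n) =
      (\<Sum>n. a (n + Suc k) / 3 ^ n) / 3 ^ Suc k + a k / 3 ^ k" .
  define s t where "s = (\<Sum>n. a (n + Suc k) / 3 ^ n) / 3 ^ Suc k" and "t = a k / 3 ^ k"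
  have "\<bar>s\<bar> \<le> (3 / 2) / 3 ^ Suc k"
    unfolding s_def abs_divide using ternary_expansion_bound[of "\<lambda>n. a (n + Suc k)", OF a]
    by (simp only: power_abs abs_numeral) (rule divide_right_mono, auto)
  moreover have "\<bar>t\<bar> = 1 / 3 ^ k" using ak by (simp add: t_def)
  moreover have "\<bar>t\<bar> - \<bar>s\<bar> \<le> \<bar>s + t\<bar>" by linarith
  ultimately have "1 / (2 * 3 ^ k) \<le> \<bar>s + t\<bar>"
    by simp
  then have "1 / (2 * 3 ^ k) \<le> \<bar>(\<Sum>n. b n / 3 ^ n) - (\<Sum>n. c n / 3 ^ n)\<bar>"
    unfolding eq s_def t_def .
  moreover have "1 / (2 * 3 ^ N) \<le> 1 / (2 * (3::real) ^ k)"
    using \<open>k \<le> n\<close> \<open>n \<le> N\<close> by (intro divide_left_mono mult_left_mono power_increasing) auto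
  ultimately show False using close by linarith
qed

text \<open>A point is encoded by the ternary expansion that records which sets of a countable family
  of small balls contain it. The encoding is far from continuous, but its inverse is uniformly
  continuous.\<close>

lemma compact_metrizable_real_encoding:
  fixes Z :: "'a topology"
  assumes Z: "compact_space Z" "metrizable_space Z"
  obtains e :: "'a \<Rightarrow> real" and K \<phi> where
    "compact K" "continuous_map (top_of_set K) Z \<phi>"
    "\<And>z. z \<in> topspace Z \<Longrightarrow> e z \<in> K" "\<And>z. z \<in> topspace Z \<Longrightarrow> \<phi> (e z) = z"
proof -
  obtain M d where M: "Metric_space M d" and Zeq: "Z = Metric_space.mtopology M d"
    using Z(2) metrizable_space_def by blast
  interpret Metric_space M d by fact
  have top: "topspace Z = M" by (simp add: Zeq)
  have complete: mcomplete and tb: "mtotally_bounded M"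
    using Z(1) compact_space_eq_mcomplete_mtotally_bounded by (auto simp: Zeq)
  have "\<exists>F. finite F \<and> F \<subseteq> M \<and> M \<subseteq> (\<Union>x\<in>F. mball x (1 / Suc k))" for k
    using tb unfolding mtotally_bounded_def by simp
  then obtain F where F: "\<And>k. finite (F k)" "\<And>k. F k \<subseteq> M"
    "\<And>k. M \<subseteq> (\<Union>x\<in>F k. mball x (1 / Suc k))"
    by metis
  \<comment> \<open>Pairs of a scale and a centre. The extra element keeps the enumerated set
    nonempty and adds at most one arbitrary digit to the code.\<close>
  define A where "A = insert undefined (Sigma UNIV F)"
  have "countable A" unfolding A_def using F(1) by (intro countable_insert countable_SIGMA) (auto intro: countable_finite)
  define U where "U n = (case from_nat_into A n of (k, x) \<Rightarrow> mball x (1 / Suc k))" for n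
  define b where "b z n = (if z \<in> U n then 1 else 0 :: real)" for z n
  define e where "e z = (\<Sum>n. b z n / 3 ^ n)" for z
  have b01: "b z n \<in> {0, 1}" for z n by (simp add: b_def)
  \<comment> \<open>The balls of scale \<open>k\<close> are finitely many, so their digits have
    positions at most some \<open>N\<close>. Codes closer than 1 / (2 * 3^N) agree there, which puts
    both points into a common ball of radius 1 / (k + 1).\<close>
  have unif: "\<exists>\<delta>>0. \<forall>z\<in>M. \<forall>w\<in>M. \<bar>e w - e z\<bar> < \<delta> \<longrightarrow> d w z < \<epsilon>" if \<epsilon>: "\<epsilon> > 0" for \<epsilon>
  proof -
    obtain k where k: "2 / Suc k < \<epsilon>"
    proof -
      obtain k where "inverse (real (Suc k)) < \<epsilon> / 2"
        using reals_Archimedean[of "\<epsilon> / 2"] \<epsilon> by auto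
      then show ?thesis by (intro that[of k]) (simp add: field_simps)
    qed
    have "\<exists>n. from_nat_into A n = (k, x)" if "x \<in> F k" for x
      using that \<open>countable A\<close> by (intro from_nat_into_surj) (auto simp: A_def)
    then obtain idx where idx: "\<And>x. x \<in> F k \<Longrightarrow> from_nat_into A (idx x) = (k, x)"
      by metis
    obtain N where N: "\<And>x. x \<in> F k \<Longrightarrow> idx x \<le> N"
      using F(1)[of k] by (metis finite_imageI finite_nat_set_iff_bounded_le image_eqI)
    have "d w z < \<epsilon>" if zw: "z \<in> M" "w \<in> M" "\<bar>e w - e z\<bar> < 1 / (2 * 3 ^ N)" for z w
    proof -
      obtain x where x: "x \<in> F k" "z \<in> mball x (1 / Suc k)" using F(3)[of k] zw by auto
      have "b w (idx x) = b z (idx x)"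
        using zw(3) unfolding e_def by (rule ternary_expansion_inj[OF b01 b01 _ N[OF x(1)]])
      then have "w \<in> mball x (1 / Suc k)"
        using x idx[OF x(1)] by (auto simp: b_def U_def split: if_splits)
      then have "d w z < 1 / Suc k + 1 / Suc k"
        using x triangle[of w x z] by (auto simp: commute)
      with k show ?thesis by simp
    qed
    then show ?thesis
      by (intro exI[of _ "1 / (2 * 3 ^ N)"]) auto
  qed
  have inj: "inj_on e M"
  proof (rule inj_onI)
    fix z w assume zw: "z \<in> M" "w \<in> M" "e z = e w"
    have "d w z < \<epsilon>" if "\<epsilon> > 0" for \<epsilon>
      using unif[OF that] zw by auto
    then have "d w z \<le> 0" using field_le_epsilon by (metis add_0 less_le)
    then show "z = w" using zw nonneg[of w z] zero by (simp add: antisym)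
  qed
  define m1 where "m1 = (euclidean_metric :: real metric)"
  have ext: "uniformly_continuous_map (submetric m1 (e ` M)) (metric (M, d)) (inv_into M e)"
    unfolding uniformly_continuous_map_def
  proof (intro conjI allI impI)
    show "inv_into M e \<in> mspace (submetric m1 (e ` M)) \<rightarrow> mspace (metric (M, d))"
      using inj by (auto simp: m1_def)
    fix \<epsilon> :: real assume "\<epsilon> > 0"
    then show "\<exists>\<delta>>0. \<forall>x\<in>mspace (submetric m1 (e ` M)). \<forall>y\<in>mspace (submetric m1 (e ` M)).
          mdist (submetric m1 (e ` M)) y x < \<delta> \<longrightarrow>
          mdist (metric (M, d)) (inv_into M e y) (inv_into M e x) < \<epsilon>"
      using unif[of \<epsilon>] inj by (auto simp: m1_def dist_real_def)
  qed
  \<comment> \<open>The set of codes need not be closed, hence need not be compact. Completeness of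
    \<open>M\<close> lets the uniformly continuous decoding extend to the closure, which is bounded
    and serves as \<open>K\<close>.\<close>
  obtain \<phi> where \<phi>: "continuous_map (subtopology (mtopology_of m1) (mtopology_of m1 closure_of (e ` M)))
        (mtopology_of (metric (M, d))) \<phi>" "\<And>x. x \<in> e ` M \<Longrightarrow> \<phi> x = inv_into M e x"
    using Cauchy_continuous_map_extends_to_continuous_closure_of[OF _
        uniformly_imp_Cauchy_continuous_map[OF ext]] complete
    by (metis mcomplete_of_def mdist_metric mspace_metric)
  show ?thesis
  proof (rule that)
    have "\<bar>e z\<bar> \<le> 3 / 2" for z
      unfolding e_def by (intro ternary_expansion_bound) (simp add: b_def)
    then have "bounded (e ` M)" by (intro boundedI[of _ "3/2"]) auto
    then show "compact (closure (e ` M))" by (simp add: compact_closure)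
    show "continuous_map (top_of_set (closure (e ` M))) Z \<phi>"
      using \<phi>(1) by (simp add: m1_def Zeq mtopology_of_def)
    show "e z \<in> closure (e ` M)" if "z \<in> topspace Z" for z
      using that closure_subset[of "e ` M"] by (auto simp: top)
    show "\<phi> (e z) = z" if "z \<in> topspace Z" for z
      using that \<phi>(2) inj by (auto simp: top)
  qed
qed

section \<open>Weak sequential compactness of empirical measures\<close>

lemma integral_pmf_of_set_lessThan:
  fixes f :: "nat \<Rightarrow> real"
  assumes "n > 0"
  shows "(\<integral>j. f j \<partial>measure_pmf (pmf_of_set {..<n})) = (\<Sum>j<n. f j) / real n"
  using assms by (subst integral_pmf_of_set) (auto simp: lessThan_empty_iff)

text \<open>The coding \<open>e\<close> moves the empirical measures to a bounded part of the real
  line, where they are tight, and \<open>\<phi>\<close> carries a limit back. Discontinuity of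
  \<open>e\<close> does no harm: a test function \<open>f\<close> enters only through its
  composition with \<open>\<phi>\<close>, which is continuous on \<open>K\<close> and takes the
  value \<open>f (z j)\<close> at the code of \<open>z j\<close>.\<close>

lemma empirical_measures_subseq_converge:
  fixes Z :: "'a topology" and z :: "nat \<Rightarrow> 'a"
  assumes Z: "compact_space Z" "metrizable_space Z" and z: "\<And>j. z j \<in> topspace Z"
  obtains \<rho> r where "prob_space \<rho>" "sets \<rho> = sets (borel_of Z)" "strict_mono (r :: nat \<Rightarrow> nat)"
    "\<And>f. continuous_map Z euclideanreal f \<Longrightarrow>
        (\<lambda>k. (\<Sum>j<r k. f (z j)) / real (r k)) \<longlonglongrightarrow> (\<integral>y. f y \<partial>\<rho>)"
proof -
  obtain e :: "'a \<Rightarrow> real" and K \<phi> where K: "compact K" and \<phi>: "continuous_map (top_of_set K) Z \<phi>"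
    and e: "\<And>z. z \<in> topspace Z \<Longrightarrow> e z \<in> K" "\<And>z. z \<in> topspace Z \<Longrightarrow> \<phi> (e z) = z"
    using compact_metrizable_real_encoding[OF Z] by metis
  have Kne: "K \<noteq> {}" and Kcl: "closed K"
    using e(1) z K compact_imp_closed by auto
  \<comment> \<open>\<open>Suc n\<close> keeps the index set nonempty; hence the times obtained in
    the end are \<open>Suc (r k)\<close>.\<close>
  define \<mu> where "\<mu> n = distr (measure_pmf (pmf_of_set {..<Suc n})) borel (\<lambda>j. e (z j))" for n
  have rd: "real_distribution (\<mu> n)" for n
  proof -
    interpret prob_space "\<mu> n"
      unfolding \<mu>_def by (rule measure_pmf.prob_space_distr) simp
    show ?thesis by unfold_locales (simp_all add: \<mu>_def)
  qed
  have int: "(\<integral>t. g t \<partial>\<mu> n) = (\<Sum>j<Suc n. g (e (z j))) / real (Suc n)"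
    if "g \<in> borel_measurable borel" for n and g :: "real \<Rightarrow> real"
    unfolding \<mu>_def using that
    by (subst integral_distr) (simp_all add: integral_pmf_of_set_lessThan del: sum.lessThan_Suc of_nat_Suc)
  obtain B where B: "\<And>t. t \<in> K \<Longrightarrow> \<bar>t\<bar> < B" "B > 0"
    using compact_imp_bounded[OF K] bounded_pos_less[of K] by auto
  have "tight \<mu>"
    unfolding tight_def
  proof (intro conjI allI impI rd)
    fix \<epsilon> :: real assume "\<epsilon> > 0"
    have "measure (\<mu> n) {-B<..B} = 1" for n
    proof -
      have "(\<lambda>j. e (z j)) -` {-B<..B} = UNIV"
        using B(1)[OF e(1)[OF z]] by (auto simp: abs_less_iff minus_less_iff less_imp_le)
      then show ?thesis
        unfolding \<mu>_def by (subst measure_distr) (auto simp: measure_pmf.prob_space[simplified])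
    qed
    with B \<open>\<epsilon> > 0\<close> show "\<exists>a b. a < b \<and> (\<forall>n. 1 - \<epsilon> < measure (\<mu> n) {a<..b})"
      by (intro exI[of _ "-B"] exI[of _ B]) auto
  qed
  from tight_imp_convergent_subsubsequence[OF this strict_mono_id]
  obtain r M where r: "strict_mono (r :: nat \<Rightarrow> nat)" and M: "real_distribution M"
    and "weak_conv_m (\<mu> \<circ> id \<circ> r) M" by blast
  then have wc: "weak_conv_m (\<lambda>k. \<mu> (r k)) M" by (simp add: comp_def)
  interpret M: real_distribution M by fact
  have lim: "(\<lambda>k. (\<Sum>j<Suc (r k). g (e (z j))) / real (Suc (r k))) \<longlonglongrightarrow> (\<integral>t. g t \<partial>M)"
    if "continuous_on UNIV g" "\<And>t. \<bar>g t\<bar> \<le> C" for g :: "real \<Rightarrow> real" and C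
  proof -
    have "(\<lambda>k. \<integral>t. g t \<partial>\<mu> (r k)) \<longlonglongrightarrow> (\<integral>t. g t \<partial>M)"
      by (rule weak_conv_imp_integral_bdd_continuous_conv[OF rd M wc, of g C])
        (use that in \<open>auto simp: continuous_on_eq_continuous_at\<close>)
    then show ?thesis
      by (simp only: int borel_measurable_continuous_onI[OF that(1)])
  qed
  \<comment> \<open>The limit lives on \<open>K\<close>: the truncated distance to \<open>K\<close>
    is a bounded continuous function that vanishes at all codes, so its integral against the limit
    is 0 as well.\<close>
  have "AE t in M. min 1 (infdist t K) = 0"
  proof -
    have c: "continuous_on UNIV (\<lambda>t. min 1 (infdist t K))"
      by (intro continuous_intros)
    have b: "\<bar>min 1 (infdist t K)\<bar> \<le> 1" for t
      using infdist_nonneg[of t K] by (auto simp: min_def)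
    have "infdist (e (z j)) K = 0" for j
      using e(1)[OF z] by (simp add: infdist_zero)
    then have "(\<integral>t. min 1 (infdist t K) \<partial>M) = 0"
      using lim[OF c b] by (simp add: LIMSEQ_const_iff)
    moreover have "integrable M (\<lambda>t. min 1 (infdist t K))"
      by (rule M.integrable_const_bound[where B=1])
        (use b borel_measurable_continuous_onI[OF c] in auto)
    ultimately show ?thesis
      using infdist_nonneg[of _ K] by (subst (asm) integral_nonneg_eq_0_iff_AE) auto
  qed
  then have AEK: "AE t in M. t \<in> K"
    by eventually_elim (use in_closed_iff_infdist_zero[OF Kcl Kne] in \<open>auto simp: min_def split: if_splits\<close>)
  \<comment> \<open>The value \<open>z 0\<close> off \<open>K\<close> is arbitrary in the space. It
    makes the decoding a Borel map on the whole line and is taken only on a null set of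
    \<open>M\<close>.\<close>
  define \<psi> where "\<psi> t = (if t \<in> K then \<phi> t else z 0)" for t
  have Kb[measurable]: "K \<in> sets borel" using Kcl by simp
  have \<phi>m: "\<phi> \<in> measurable (restrict_space borel K) (borel_of Z)"
  proof (rule measurable_borel_ofI[OF Z(2)])
    show "\<phi> \<in> space (restrict_space borel K) \<rightarrow> topspace Z"
      using continuous_map_funspace[OF \<phi>] by (simp add: space_restrict_space)
    fix f assume "continuous_map Z euclideanreal f"
    then have "continuous_map (top_of_set K) euclideanreal (f \<circ> \<phi>)"
      using \<phi> continuous_map_compose by blast
    then have "continuous_on K (\<lambda>t. f (\<phi> t))"
      by (simp add: comp_def)
    then show "(\<lambda>t. f (\<phi> t)) \<in> borel_measurable (restrict_space borel K)"
      by (rule borel_measurable_continuous_on_restrict)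
  qed
  have \<psi>m: "\<psi> \<in> measurable borel (borel_of Z)"
    unfolding \<psi>_def
    by (rule measurable_If_restrict_space_iff[THEN iffD2])
      (use \<phi>m z[of 0] in auto)
  then have \<psi>M: "\<psi> \<in> measurable M (borel_of Z)"
    by (simp add: measurable_cong_sets[OF M.events_eq_borel refl])
  define \<rho> where "\<rho> = distr M (borel_of Z) \<psi>"
  show ?thesis
  proof
    show "prob_space \<rho>" unfolding \<rho>_def by (rule M.prob_space_distr[OF \<psi>M])
    show "sets \<rho> = sets (borel_of Z)" by (simp add: \<rho>_def)
    show "strict_mono (\<lambda>k. Suc (r k))" using r by (simp add: strict_mono_def)
    fix f assume f: "continuous_map Z euclideanreal f"
    then have "continuous_map (top_of_set K) euclideanreal (f \<circ> \<phi>)"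
      using \<phi> continuous_map_compose by blast
    then have fc: "continuous_on K (\<lambda>t. f (\<phi> t))"
      by (simp add: comp_def)
    obtain C where C: "C > 0" "\<And>y. y \<in> topspace Z \<Longrightarrow> \<bar>f y\<bar> \<le> C"
      using continuous_map_bounded_on_compact[OF Z(1) f] by blast
    \<comment> \<open>Weak convergence on the line tests with bounded continuous functions on all of
      it, so the function on \<open>K\<close> is extended by Tietze with the same bound.\<close>
    obtain g where g: "continuous_on UNIV g" "\<And>t. t \<in> K \<Longrightarrow> g t = f (\<phi> t)" "\<And>t. norm (g t) \<le> C"
    proof (rule Tietze[of K "\<lambda>t. f (\<phi> t)" UNIV C])
      show "norm (f (\<phi> t)) \<le> C" if "t \<in> K" for t
        using C(2) continuous_map_funspace[OF \<phi>] that by (auto simp: Pi_iff)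
    qed (use fc Kcl C(1) in \<open>auto intro: that\<close>)
    have "(\<integral>y. f y \<partial>\<rho>) = (\<integral>t. f (\<psi> t) \<partial>M)"
      unfolding \<rho>_def by (rule integral_distr[OF \<psi>M borel_measurable_continuous_map[OF f]])
    also have "\<dots> = (\<integral>t. g t \<partial>M)"
    proof (rule integral_cong_AE)
      show "AE t in M. f (\<psi> t) = g t"
        using AEK by eventually_elim (simp add: \<psi>_def g)
      show "(\<lambda>t. f (\<psi> t)) \<in> borel_measurable M"
        using measurable_compose[OF \<psi>M borel_measurable_continuous_map[OF f]] .
      show "g \<in> borel_measurable M"
        using borel_measurable_continuous_onI[OF g(1)] by simp
    qed
    finally show "(\<lambda>k. (\<Sum>j<Suc (r k). f (z j)) / real (Suc (r k))) \<longlonglongrightarrow> (\<integral>y. f y \<partial>\<rho>)"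
      using lim[OF g(1), of C] g(2)[OF e(1)[OF z]] g(3) e(2)[OF z] by simp
  qed
qed

subsection \<open>Factors and joinings\<close>

lemma invariant_measuresD:
  assumes "\<mu> \<in> invariant_measures X T"
  shows "prob_space \<mu>" "sets \<mu> = sets (borel_of X)" "space \<mu> = topspace X" "distr \<mu> (borel_of X) T = \<mu>"
proof -
  show s: "prob_space \<mu>" "sets \<mu> = sets (borel_of X)"
    using assms by (simp_all add: invariant_measures_def)
  show "space \<mu> = topspace X"
    using sets_eq_imp_space_eq[OF s(2)] by simp
  have "distr \<mu> \<mu> T = distr \<mu> (borel_of X) T"
    by (rule distr_cong) (simp_all add: s)
  then show "distr \<mu> (borel_of X) T = \<mu>"
    using assms by (simp add: invariant_measures_def)
qed

lemma invariant_measures_factor: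
  assumes \<mu>: "\<mu> \<in> invariant_measures X T"
    and T: "T \<in> measurable (borel_of X) (borel_of X)" and S: "S \<in> measurable (borel_of Y) (borel_of Y)"
    and fac: "is_factor Y \<nu> S X \<mu> T"
  shows "\<nu> \<in> invariant_measures Y S"
proof -
  note \<mu>D = invariant_measuresD[OF \<mu>]
  obtain \<pi> where \<pi>: "\<pi> \<in> measurable (borel_of X) (borel_of Y)"
    and eq: "\<And>x. x \<in> topspace X \<Longrightarrow> \<pi> (T x) = S (\<pi> x)" and \<nu>: "\<nu> = distr \<mu> (borel_of Y) \<pi>"
    using fac unfolding is_factor_def by blast
  have m: "measurable \<mu> N = measurable (borel_of X) N" for N :: "'c measure"
    by (rule measurable_cong_sets[OF \<mu>D(2) refl])
  have "distr \<nu> \<nu> S = distr \<nu> (borel_of Y) S"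
    by (rule distr_cong) (simp_all add: \<nu>)
  also have "\<dots> = distr \<mu> (borel_of Y) (S \<circ> \<pi>)"
    unfolding \<nu> using S \<pi> by (intro distr_distr) (simp_all add: m)
  also have "\<dots> = distr \<mu> (borel_of Y) (\<pi> \<circ> T)"
    by (rule distr_cong) (simp_all add: \<mu>D eq)
  also have "\<dots> = distr (distr \<mu> (borel_of X) T) (borel_of Y) \<pi>"
    using T \<pi> by (intro distr_distr[symmetric]) (simp_all add: m)
  finally have "distr \<nu> \<nu> S = \<nu>"
    by (simp add: \<mu>D \<nu>)
  moreover have "prob_space \<nu>"
    unfolding \<nu> using prob_space.prob_space_distr[OF \<mu>D(1)] \<pi> by (simp add: m)
  ultimately show ?thesis by (simp add: invariant_measures_def \<nu>)
qed

lemma characteristic_class_mp_system: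
  "characteristic_class \<C> \<Longrightarrow> (X, \<mu>, T) \<in> \<C> \<Longrightarrow> mp_system X \<mu> T"
  unfolding characteristic_class_def by blast

lemma characteristic_class_factor:
  "characteristic_class \<C> \<Longrightarrow> (X, \<mu>, T) \<in> \<C> \<Longrightarrow> mp_system Y \<nu> S \<Longrightarrow> is_factor Y \<nu> S X \<mu> T \<Longrightarrow>
    (Y, \<nu>, S) \<in> \<C>"
  unfolding characteristic_class_def by blast

lemma characteristic_class_joining:
  fixes I :: "nat set"
  shows "characteristic_class \<C> \<Longrightarrow> (\<And>i. i \<in> I \<Longrightarrow> (X i, \<mu> i, T i) \<in> \<C>) \<Longrightarrow>
    is_joining I X \<mu> T \<rho> \<Longrightarrow> belongs \<C> (product_topology X I) \<rho> (prod_map I T)"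
  unfolding characteristic_class_def by blast

lemma mp_systemD:
  assumes "mp_system X \<mu> T"
  shows "compact_space X" "metrizable_space X" "homeomorphic_map X X T" "continuous_map X X T"
    "\<mu> \<in> invariant_measures X T"
  using assms homeomorphic_imp_continuous_map by (auto simp: mp_system_def)

lemma distr_homeomorphic_maps_inverse:
  assumes hg: "homeomorphic_maps X Y h g" and "sets \<mu> = sets (borel_of X)"
  shows "distr (distr \<mu> (borel_of Y) h) (borel_of X) g = \<mu>"
proof -
  have "h \<in> measurable \<mu> (borel_of Y)" "g \<in> measurable (borel_of Y) (borel_of X)"
    unfolding measurable_cong_sets[OF assms(2) refl]
    using hg by (auto simp: homeomorphic_maps_def intro!: measurable_continuous_map)
  then have "distr (distr \<mu> (borel_of Y) h) (borel_of X) g = distr \<mu> (borel_of X) (g \<circ> h)"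
    by (intro distr_distr) auto
  also have "\<dots> = distr \<mu> \<mu> (\<lambda>x. x)"
    using hg assms(2) sets_eq_imp_space_eq[OF assms(2)]
    by (intro distr_cong) (auto simp: homeomorphic_maps_def)
  finally show ?thesis by simp
qed

lemma homeomorphic_maps_equivariant_inverse:
  assumes hg: "homeomorphic_maps X Y h g" and R: "R \<in> topspace X \<rightarrow> topspace X"
    and eq: "\<And>x. x \<in> topspace X \<Longrightarrow> h (R x) = S (h x)" and y: "y \<in> topspace Y"
  shows "g (S y) = R (g y)"
proof -
  have gy: "g y \<in> topspace X" "h (g y) = y"
    using hg y by (auto simp: homeomorphic_maps_def continuous_map_def)
  then have "g (S y) = g (h (R (g y)))" by (simp add: eq)
  also have "\<dots> = R (g y)" using hg gy(1) R by (auto simp: homeomorphic_maps_def)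
  finally show ?thesis .
qed

text \<open>Composing the factor map with the inverse homeomorphism makes \<open>Y\<close> a factor
  of the copy that really lies in the class. This is needed for joinings, since closure under
  joinings provides only a copy of the product.\<close>

lemma belongs_factor:
  assumes \<C>: "characteristic_class \<C>" and Z: "belongs \<C> Z \<rho> R" "sets \<rho> = sets (borel_of Z)"
    and R: "R \<in> topspace Z \<rightarrow> topspace Z"
    and Y: "mp_system Y \<nu> S" and fac: "is_factor Y \<nu> S Z \<rho> R"
  shows "(Y, \<nu>, S) \<in> \<C>"
proof -
  obtain W \<omega> Q h where W: "(W, \<omega>, Q) \<in> \<C>" and h: "homeomorphic_map Z W h"
    and hR: "\<And>z. z \<in> topspace Z \<Longrightarrow> h (R z) = Q (h z)" and \<omega>: "distr \<rho> (borel_of W) h = \<omega>"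
    using Z(1) by (auto simp: belongs_def)
  obtain g where hg: "homeomorphic_maps Z W h g"
    using h homeomorphic_map_maps by blast
  obtain \<pi> where \<pi>: "\<pi> \<in> measurable (borel_of Z) (borel_of Y)"
    and eq: "\<And>z. z \<in> topspace Z \<Longrightarrow> \<pi> (R z) = S (\<pi> z)" and \<nu>: "distr \<rho> (borel_of Y) \<pi> = \<nu>"
    using fac unfolding is_factor_def by blast
  have g: "continuous_map W Z g" using hg by (simp add: homeomorphic_maps_def)
  have gm: "g \<in> measurable (borel_of W) (borel_of Z)" by (rule measurable_continuous_map[OF g])
  have "is_factor Y \<nu> S W \<omega> Q"
    unfolding is_factor_def
  proof (intro bexI conjI ballI)
    show "\<pi> \<circ> g \<in> measurable (borel_of W) (borel_of Y)"
      using gm \<pi> by (rule measurable_comp)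
    show "(\<pi> \<circ> g) (Q w) = S ((\<pi> \<circ> g) w)" if "w \<in> topspace W" for w
      using homeomorphic_maps_equivariant_inverse[OF hg R hR that] eq[of "g w"]
        continuous_map_funspace[OF g] that by (auto simp: Pi_iff)
    have "distr \<omega> (borel_of Y) (\<pi> \<circ> g) = distr (distr \<omega> (borel_of Z) g) (borel_of Y) \<pi>"
      using gm \<pi> by (intro distr_distr[symmetric]) (auto simp: \<omega>[symmetric])
    then show "distr \<omega> (borel_of Y) (\<pi> \<circ> g) = \<nu>"
      using distr_homeomorphic_maps_inverse[OF hg Z(2)] by (simp add: \<omega> \<nu>)
  qed
  then show ?thesis
    using characteristic_class_factor[OF \<C> W Y] by blast
qed

section \<open>Generic points under equivariant continuous maps and in countable products\<close>

lemma funpow_in_topspace: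
  assumes "T \<in> topspace X \<rightarrow> topspace X" "x \<in> topspace X"
  shows "(T ^^ j) x \<in> topspace X"
  using assms by (induction j) auto

lemma funpow_equivariant:
  assumes T: "T \<in> topspace X \<rightarrow> topspace X" and eq: "\<And>x. x \<in> topspace X \<Longrightarrow> h (T x) = S (h x)"
    and x: "x \<in> topspace X"
  shows "(S ^^ j) (h x) = h ((T ^^ j) x)"
  by (induction j) (simp_all add: eq funpow_in_topspace[OF T x])

text \<open>A continuous test function on \<open>Y\<close> pulls back to a continuous one on
  \<open>X\<close> with the same orbit averages. For a map that is only measurable, such as the
  limit map, the pullback need not be continuous, so this route is reserved for homeomorphic
  copies.\<close>

lemma generic_points_image:
  assumes x: "x \<in> generic_points X T \<mu>" and T: "T \<in> topspace X \<rightarrow> topspace X"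
    and h: "continuous_map X Y h" and eq: "\<And>x. x \<in> topspace X \<Longrightarrow> h (T x) = S (h x)"
    and \<mu>: "sets \<mu> = sets (borel_of X)"
  shows "h x \<in> generic_points Y S (distr \<mu> (borel_of Y) h)"
proof -
  have xX: "x \<in> topspace X" using x by (simp add: generic_points_def)
  have "(\<lambda>n. (\<Sum>j<n. f ((S ^^ j) (h x))) / real n) \<longlonglongrightarrow> (\<integral>y. f y \<partial>distr \<mu> (borel_of Y) h)"
    if f: "continuous_map Y euclideanreal f" for f
  proof -
    have "continuous_map X euclideanreal (f \<circ> h)" using h f by (rule continuous_map_compose)
    then have "(\<lambda>n. (\<Sum>j<n. f (h ((T ^^ j) x))) / real n) \<longlonglongrightarrow> (\<integral>y. f (h y) \<partial>\<mu>)"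
      using x unfolding generic_points_def comp_def by blast
    moreover have "(\<integral>y. f y \<partial>distr \<mu> (borel_of Y) h) = (\<integral>y. f (h y) \<partial>\<mu>)"
      using measurable_continuous_map[OF h] borel_measurable_continuous_map[OF f]
      by (intro integral_distr) (simp_all add: measurable_cong_sets[OF \<mu> refl])
    ultimately show ?thesis
      by (simp add: funpow_equivariant[where S=S and h=h, OF T eq xX])
  qed
  then show ?thesis
    using continuous_map_funspace[OF h] xX by (auto simp: generic_points_def)
qed

lemma continuous_map_prod_map:
  assumes "\<And>i. i \<in> I \<Longrightarrow> continuous_map (X i) (X i) (T i)"
  shows "continuous_map (product_topology X I) (product_topology X I) (prod_map I T)"
proof -
  have "continuous_map (product_topology X I) (X i) (\<lambda>y. T i (y i))" if "i \<in> I" for i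
  proof -
    have "continuous_map (product_topology X I) (X i) (T i \<circ> (\<lambda>y. y i))"
      by (rule continuous_map_compose[OF continuous_map_product_projection[OF that, where X=X] assms[OF that]])
    then show ?thesis by (simp add: comp_def)
  qed
  then show ?thesis
    unfolding continuous_map_componentwise by (auto simp: prod_map_def)
qed

text \<open>A weak limit of the empirical measures of the point \<open>xs\<close> of the product is
  invariant. Its marginals are forced: each \<open>xs i\<close> is generic, so the averages in one
  coordinate converge to the integral against \<open>\<mu> i\<close> along any sequence of times.
  Convergence is claimed only along \<open>r\<close>, because the point of the product need not be
  generic for any measure.\<close>

lemma generic_points_joining:
  fixes X :: "'i \<Rightarrow> 'a topology"
  assumes I: "countable I" and sys: "\<And>i. i \<in> I \<Longrightarrow> mp_system (X i) (\<mu> i) (T i)"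
    and xs: "\<And>i. i \<in> I \<Longrightarrow> xs i \<in> generic_points (X i) (T i) (\<mu> i)"
  obtains \<rho> r where "is_joining I X \<mu> T \<rho>" "strict_mono (r :: nat \<Rightarrow> nat)"
    "\<And>f. continuous_map (product_topology X I) euclideanreal f \<Longrightarrow>
        (\<lambda>k. (\<Sum>j<r k. f (\<lambda>i\<in>I. (T i ^^ j) (xs i))) / real (r k)) \<longlonglongrightarrow> (\<integral>y. f y \<partial>\<rho>)"
proof -
  define Z where "Z = product_topology X I"
  define z where "z j = (\<lambda>i\<in>I. (T i ^^ j) (xs i))" for j
  note sysD = mp_systemD[OF sys]
  have Z: "compact_space Z" "metrizable_space Z"
    using sysD(1,2) I unfolding Z_def
    by (auto simp: compact_space_product_topology metrizable_space_product_topology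
        intro: countable_subset[OF _ I])
  have xsX: "xs i \<in> topspace (X i)" if "i \<in> I" for i
    using xs[OF that] by (simp add: generic_points_def)
  have zZ: "z j \<in> topspace Z" for j
    using funpow_in_topspace[OF continuous_map_funspace[OF sysD(4)] xsX]
    by (auto simp: Z_def z_def)
  have zSuc: "prod_map I T (z j) = z (Suc j)" for j
    by (auto simp: prod_map_def z_def)
  have R: "continuous_map Z Z (prod_map I T)"
    unfolding Z_def by (rule continuous_map_prod_map[OF sysD(4)])
  obtain \<rho> r where \<rho>: "prob_space \<rho>" "sets \<rho> = sets (borel_of Z)" and r: "strict_mono (r :: nat \<Rightarrow> nat)"
    and lim: "\<And>f. continuous_map Z euclideanreal f \<Longrightarrow>
        (\<lambda>k. (\<Sum>j<r k. f (z j)) / real (r k)) \<longlonglongrightarrow> (\<integral>y. f y \<partial>\<rho>)"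
    by (rule empirical_measures_subseq_converge[OF Z, of z, OF zZ]) blast
  have m: "measurable \<rho> N = measurable (borel_of Z) N" for N :: "'c measure"
    by (rule measurable_cong_sets[OF \<rho>(2) refl])
  have rlim: "filterlim r at_top sequentially"
    by (rule filterlim_subseq[OF r])
  have inv: "distr \<rho> (borel_of Z) (prod_map I T) = \<rho>"
  proof (rule measure_eqI_continuous_map[OF Z(2)])
    have Rm: "prod_map I T \<in> measurable \<rho> (borel_of Z)"
      using measurable_continuous_map[OF R] by (simp add: m)
    then show "prob_space (distr \<rho> (borel_of Z) (prod_map I T))"
      by (rule prob_space.prob_space_distr[OF \<rho>(1)])
    fix f assume f: "continuous_map Z euclideanreal f"
    obtain B where B: "\<And>y. y \<in> topspace Z \<Longrightarrow> \<bar>f y\<bar> \<le> B"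
      using continuous_map_bounded_on_compact[OF Z(1) f] by metis
    have shift: "(\<lambda>k. (\<Sum>j<r k. f (z (Suc j))) / real (r k)) \<longlonglongrightarrow> (\<integral>y. f (prod_map I T y) \<partial>\<rho>)"
      using lim[OF continuous_map_compose[OF R f]] by (simp add: zSuc)
    have "(\<integral>y. f (prod_map I T y) \<partial>\<rho>) = (\<integral>y. f y \<partial>distr \<rho> (borel_of Z) (prod_map I T))"
      by (rule integral_distr[symmetric, OF Rm borel_measurable_continuous_map[OF f]])
    moreover have null: "(\<lambda>k. (\<Sum>j<r k. f (z (Suc j))) / real (r k) - (\<Sum>j<r k. f (z j)) / real (r k)) \<longlonglongrightarrow> 0"
    proof -
      \<comment> \<open>A shift by one step changes the sum only by its two end terms. These are
        bounded by \<open>B\<close>, so the averages differ by at most 2 * B / n.\<close>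
      have eq: "(\<Sum>j<n. f (z (Suc j))) / real n - (\<Sum>j<n. f (z j)) / real n = (f (z n) - f (z 0)) / real n" for n
        using sum_lessThan_telescope[of "\<lambda>j. f (z j)" n]
        by (simp add: diff_divide_distrib[symmetric] sum_subtractf)
      have "(\<lambda>n. (f (z n) - f (z 0)) / real n) \<longlonglongrightarrow> 0"
      proof (rule tendsto_0_le[where K=1])
        show "(\<lambda>n. 2 * B / real n) \<longlonglongrightarrow> 0" by (rule lim_const_over_n)
        have "\<bar>f (z n) - f (z 0)\<bar> \<le> \<bar>2 * B\<bar>" for n
          using B[OF zZ[of n]] B[OF zZ[of 0]] by linarith
        then show "\<forall>\<^sub>F n in sequentially. norm ((f (z n) - f (z 0)) / real n) \<le> norm (2 * B / real n) * 1"
          by (auto simp: divide_right_mono intro!: always_eventually)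
      qed
      then show ?thesis
        unfolding eq using filterlim_compose[OF _ rlim] by blast
    qed
    ultimately show "(\<integral>y. f y \<partial>distr \<rho> (borel_of Z) (prod_map I T)) = (\<integral>y. f y \<partial>\<rho>)"
      using LIMSEQ_unique[OF tendsto_diff[OF shift lim[OF f]] null] by simp
  qed (use \<rho> in simp_all)
  have marg: "distr \<rho> (borel_of (X i)) (\<lambda>y. y i) = \<mu> i" if i: "i \<in> I" for i
  proof (rule measure_eqI_continuous_map[OF sysD(2)[OF i]])
    have p: "continuous_map Z (X i) (\<lambda>y. y i)"
      unfolding Z_def by (rule continuous_map_product_projection[OF i])
    have pm: "(\<lambda>y. y i) \<in> measurable \<rho> (borel_of (X i))"
      using measurable_continuous_map[OF p] by (simp add: m)
    then show "prob_space (distr \<rho> (borel_of (X i)) (\<lambda>y. y i))"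
      by (rule prob_space.prob_space_distr[OF \<rho>(1)])
    show "prob_space (\<mu> i)" "sets (\<mu> i) = sets (borel_of (X i))"
      using invariant_measuresD[OF sysD(5)[OF i]] by auto
    fix f assume f: "continuous_map (X i) euclideanreal f"
    have "(\<lambda>k. (\<Sum>j<r k. f ((T i ^^ j) (xs i))) / real (r k)) \<longlonglongrightarrow> (\<integral>y. f (y i) \<partial>\<rho>)"
      using lim[OF continuous_map_compose[OF p f]] i by (simp add: z_def)
    moreover have "(\<lambda>n. (\<Sum>j<n. f ((T i ^^ j) (xs i))) / real n) \<longlonglongrightarrow> (\<integral>y. f y \<partial>\<mu> i)"
      using xs[OF i] f by (simp add: generic_points_def)
    then have "(\<lambda>k. (\<Sum>j<r k. f ((T i ^^ j) (xs i))) / real (r k)) \<longlonglongrightarrow> (\<integral>y. f y \<partial>\<mu> i)"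
      using filterlim_compose[OF _ rlim] by blast
    ultimately have "(\<integral>y. f (y i) \<partial>\<rho>) = (\<integral>y. f y \<partial>\<mu> i)"
      by (rule LIMSEQ_unique)
    then show "(\<integral>y. f y \<partial>distr \<rho> (borel_of (X i)) (\<lambda>y. y i)) = (\<integral>y. f y \<partial>\<mu> i)"
      by (simp add: integral_distr[OF pm borel_measurable_continuous_map[OF f]])
  qed simp
  have "distr \<rho> \<rho> (prod_map I T) = distr \<rho> (borel_of Z) (prod_map I T)"
    by (rule distr_cong) (simp_all add: \<rho>)
  with inv have "distr \<rho> \<rho> (prod_map I T) = \<rho>" by simp
  then have "is_joining I X \<mu> T \<rho>"
    using \<rho> marg by (simp add: is_joining_def invariant_measures_def Z_def)
  with r lim show ?thesis
    by (intro that) (simp_all add: Z_def z_def)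
qed

subsection \<open>Almost surely convergent joinings\<close>

text \<open>The junk value \<open>y 0\<close> for divergent sequences makes the limit map commute with every
  homeomorphism at all points, as the definition of a factor requires.\<close>

definition seq_limit :: "'a topology \<Rightarrow> (nat \<Rightarrow> 'a) \<Rightarrow> 'a" where
  "seq_limit X y = (if \<exists>l. limitin X y l sequentially then THE l. limitin X y l sequentially else y 0)"

lemma seq_limit_eq:
  assumes "Hausdorff_space X" "limitin X y l sequentially"
  shows "seq_limit X y = l"
  unfolding seq_limit_def
  using assms limitin_Hausdorff_unique[OF _ _ sequentially_bot assms(1), of y] by (auto intro!: the_equality)

lemma seq_limit_in_topspace:
  assumes "Hausdorff_space X" "range y \<subseteq> topspace X"
  shows "seq_limit X y \<in> topspace X"
proof (cases "\<exists>l. limitin X y l sequentially")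
  case True
  then show ?thesis
    using seq_limit_eq[OF assms(1)] limitin_topspace by metis
next
  case False
  with assms(2) show ?thesis by (auto simp: seq_limit_def)
qed

text \<open>The inverse of \<open>T\<close> carries convergence back, so \<open>y\<close> and its
  image under \<open>T\<close> converge or diverge together and both sides are computed by the same
  branch.\<close>

lemma seq_limit_equivariant:
  assumes X: "Hausdorff_space X" and T: "homeomorphic_map X X T" and y: "range y \<subseteq> topspace X"
  shows "seq_limit X (\<lambda>n. T (y n)) = T (seq_limit X y)"
proof (cases "\<exists>l. limitin X y l sequentially")
  case True
  then obtain l where l: "limitin X y l sequentially" by blast
  have "limitin X (T \<circ> y) (T l) sequentially"
    by (rule continuous_map_limit[OF homeomorphic_imp_continuous_map[OF T] l])
  then show ?thesis
    using seq_limit_eq[OF X l] seq_limit_eq[OF X, of "\<lambda>n. T (y n)" "T l"] by (simp add: comp_def)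
next
  case False
  obtain g where g: "homeomorphic_maps X X T g"
    using T homeomorphic_map_maps by blast
  have "\<not> limitin X (\<lambda>n. T (y n)) l sequentially" for l
  proof
    assume "limitin X (\<lambda>n. T (y n)) l sequentially"
    then have "limitin X (g \<circ> (\<lambda>n. T (y n))) (g l) sequentially"
      using g by (intro continuous_map_limit) (auto simp: homeomorphic_maps_def)
    moreover have "g \<circ> (\<lambda>n. T (y n)) = y"
      using g y by (auto simp: homeomorphic_maps_def fun_eq_iff)
    ultimately show False using False by simp
  qed
  with False show ?thesis by (simp add: seq_limit_def)
qed

section \<open>Measurability of the limit map, summable gaps, and a linear modulus of
  continuity\<close>

context Metric_space
begin

lemma continuous_map_mdist_projections:
  assumes "i \<in> I" "j \<in> I"
  shows "continuous_map (product_topology (\<lambda>_. mtopology) I) euclideanreal (\<lambda>y. d (y i) (y j))"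
proof -
  have "continuous_map (product_topology (\<lambda>_. mtopology) I) (prod_topology mtopology mtopology) (\<lambda>y. (y i, y j))"
    using continuous_map_product_projection[OF assms(1), where X="\<lambda>_. mtopology"]
      continuous_map_product_projection[OF assms(2), where X="\<lambda>_. mtopology"]
    by (simp add: continuous_map_pairwise comp_def)
  then show ?thesis
    using continuous_map_mdist_alt[of _ "metric (M, d)" "\<lambda>y. (y i, y j)"]
    by (simp add: mtopology_of_def)
qed

text \<open>By completeness the convergent sequences form the set \<open>G\<close> of Cauchy
  sequences, which is Borel because tolerances 1 / (k + 1) leave only countable quantifiers over
  continuous conditions. A continuous \<open>f\<close> composed with the limit map is then the
  pointwise limit of the functions \<open>f (y n)\<close> on \<open>G\<close>, with the value
  \<open>f (y 0)\<close> off \<open>G\<close>.\<close>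

lemma measurable_seq_limit:
  assumes mcomplete
  shows "seq_limit mtopology \<in> measurable (borel_of (product_topology (\<lambda>_. mtopology) UNIV)) (borel_of mtopology)"
proof -
  define Z where "Z = product_topology (\<lambda>_::nat. mtopology) UNIV"
  define G where "G = {y \<in> space (borel_of Z). \<forall>k. \<exists>N. \<forall>n\<ge>N. \<forall>n'\<ge>N. d (y n) (y n') < 1 / Suc k}"
  have dm[measurable]: "(\<lambda>y. d (y n) (y n')) \<in> borel_measurable (borel_of Z)" for n n'
    unfolding Z_def by (intro borel_measurable_continuous_map continuous_map_mdist_projections) auto
  have pm: "(\<lambda>y. y n) \<in> measurable (borel_of Z) (borel_of mtopology)" for n
    unfolding Z_def
    by (intro measurable_continuous_map continuous_map_product_projection[where X="\<lambda>_. mtopology"]) auto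
  have Gm: "G \<in> sets (borel_of Z)"
    unfolding G_def by measurable
  have range: "range y \<subseteq> M" if "y \<in> topspace Z" for y
    using that by (auto simp: Z_def PiE_iff)
  have G: "y \<in> G \<longleftrightarrow> (\<exists>l. limitin mtopology y l sequentially)" if y: "y \<in> topspace Z" for y
  proof
    assume "y \<in> G"
    have "MCauchy y"
      unfolding MCauchy_def
    proof (intro conjI range[OF y] allI impI)
      fix \<epsilon> :: real assume "\<epsilon> > 0"
      then obtain k where k: "1 / Suc k < \<epsilon>"
        using reals_Archimedean[of \<epsilon>] by (auto simp: inverse_eq_divide)
      obtain N where "\<And>n n'. n \<ge> N \<Longrightarrow> n' \<ge> N \<Longrightarrow> d (y n) (y n') < 1 / Suc k"
        using \<open>y \<in> G\<close> unfolding G_def by blast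
      with k show "\<exists>N. \<forall>n n'. N \<le> n \<longrightarrow> N \<le> n' \<longrightarrow> d (y n) (y n') < \<epsilon>"
        by (meson less_trans)
    qed
    then show "\<exists>l. limitin mtopology y l sequentially"
      using assms mcomplete_def by blast
  next
    assume "\<exists>l. limitin mtopology y l sequentially"
    then have "MCauchy y"
      using convergent_imp_MCauchy[OF range[OF y]] by blast
    then have "\<exists>N. \<forall>n n'. N \<le> n \<longrightarrow> N \<le> n' \<longrightarrow> d (y n) (y n') < 1 / Suc k" for k
      unfolding MCauchy_def by simp
    with y show "y \<in> G"
      unfolding G_def by auto
  qed
  show ?thesis
    unfolding Z_def[symmetric]
  proof (rule measurable_borel_ofI)
    show "metrizable_space mtopology" by (rule metrizable_space_mtopology)
    show "seq_limit mtopology \<in> space (borel_of Z) \<rightarrow> topspace mtopology"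
      using seq_limit_in_topspace[OF Hausdorff_space_mtopology] range by auto
    fix f assume f: "continuous_map mtopology euclideanreal f"
    have fm: "(\<lambda>y. f (y n)) \<in> borel_measurable (borel_of Z)" for n
      using measurable_compose[OF pm borel_measurable_continuous_map[OF f]] .
    show "(\<lambda>y. f (seq_limit mtopology y)) \<in> borel_measurable (borel_of Z)"
    proof (rule borel_measurable_LIMSEQ_real)
      show "(\<lambda>y. if y \<in> G then f (y n) else f (y 0)) \<in> borel_measurable (borel_of Z)" for n
        using fm sets.Int_space_eq2[OF Gm] Gm by (intro measurable_If_set) simp_all
      fix y assume "y \<in> space (borel_of Z)"
      then have y: "y \<in> topspace Z" by simp
      show "(\<lambda>n. if y \<in> G then f (y n) else f (y 0)) \<longlonglongrightarrow> f (seq_limit mtopology y)"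
      proof (cases "y \<in> G")
        case True
        then obtain l where l: "limitin mtopology y l sequentially" using G[OF y] by blast
        have "(\<lambda>n. f (y n)) \<longlonglongrightarrow> f l"
          using continuous_map_limit[OF f l] by (simp add: comp_def)
        with True show ?thesis by (simp add: seq_limit_eq[OF Hausdorff_space_mtopology l])
      next
        case False
        then have "seq_limit mtopology y = y 0"
          using G[OF y] by (simp add: seq_limit_def)
        with False show ?thesis by simp
      qed
    qed
  qed
qed

lemma MCauchy_if_summable:
  assumes \<sigma>: "range \<sigma> \<subseteq> M" and sum: "summable (\<lambda>n. d (\<sigma> n) (\<sigma> (Suc n)))"
  shows "MCauchy \<sigma>"
  unfolding MCauchy_def
proof (intro conjI \<sigma> allI impI)
  fix \<epsilon> :: real assume "\<epsilon> > 0"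
  then obtain N where N: "\<And>m n. m \<ge> N \<Longrightarrow> \<bar>\<Sum>i\<in>{m..<n}. d (\<sigma> i) (\<sigma> (Suc i))\<bar> < \<epsilon>"
    using sum unfolding summable_Cauchy real_norm_def by metis
  have \<sigma>M: "\<sigma> n \<in> M" for n using \<sigma> by auto
  have chain: "d (\<sigma> m) (\<sigma> n) \<le> (\<Sum>i\<in>{m..<n}. d (\<sigma> i) (\<sigma> (Suc i)))" if "m \<le> n" for m n
    using that
  proof (induction n rule: dec_induct)
    case base
    then show ?case using \<sigma>M by simp
  next
    case (step n)
    then show ?case using triangle[OF \<sigma>M \<sigma>M \<sigma>M, of m "Suc n" n] by simp
  qed
  have le: "d (\<sigma> m) (\<sigma> n) < \<epsilon>" if "N \<le> m" "m \<le> n" for m n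
    using chain[OF that(2)] N[OF that(1), of n] by linarith
  have "d (\<sigma> m) (\<sigma> n) < \<epsilon>" if "N \<le> m" "N \<le> n" for m n
    using le[of m n] le[of n m] that commute[of "\<sigma> m" "\<sigma> n"] by (cases "m \<le> n") auto
  then show "\<exists>N. \<forall>n n'. N \<le> n \<longrightarrow> N \<le> n' \<longrightarrow> d (\<sigma> n) (\<sigma> n') < \<epsilon>"
    by blast
qed

text \<open>For distances below \<open>\<delta>\<close> this is uniform continuity; otherwise the
  trivial bound 2 * B is at most (2 * B / \<delta>) times the distance. A bound linear in the
  distance survives averaging along orbits, as is required when only mean distances are
  controlled.\<close>

lemma continuous_map_modulus:
  assumes X: "compact_space mtopology" and f: "continuous_map mtopology euclideanreal f" and \<epsilon>: "\<epsilon> > 0"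
  obtains C where "C > 0" "\<And>a b. a \<in> M \<Longrightarrow> b \<in> M \<Longrightarrow> \<bar>f a - f b\<bar> \<le> \<epsilon> + C * d a b"
proof -
  have "uniformly_continuous_map (metric (M, d)) euclidean_metric f"
    using X f by (intro continuous_imp_uniformly_continuous_map) (simp add: mtopology_of_def)
  then obtain \<delta> where \<delta>: "\<delta> > 0" "\<And>a b. a \<in> M \<Longrightarrow> b \<in> M \<Longrightarrow> d a b < \<delta> \<Longrightarrow> \<bar>f a - f b\<bar> < \<epsilon>"
    using \<epsilon> unfolding uniformly_continuous_map_def by (auto simp: dist_real_def)
  obtain B where B: "B > 0" "\<And>a. a \<in> M \<Longrightarrow> \<bar>f a\<bar> \<le> B"
    using continuous_map_bounded_on_compact[OF X f] by (metis topspace_mtopology)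
  show ?thesis
  proof
    show "2 * B / \<delta> > 0" using B \<delta> by simp
    fix a b assume ab: "a \<in> M" "b \<in> M"
    show "\<bar>f a - f b\<bar> \<le> \<epsilon> + 2 * B / \<delta> * d a b"
    proof (cases "d a b < \<delta>")
      case True
      then show ?thesis
        using \<delta>(2)[OF ab] B(1) \<delta>(1) by (smt (verit) divide_nonneg_pos mult_nonneg_nonneg nonneg)
    next
      case False
      then have "2 * B \<le> 2 * B / \<delta> * d a b"
        using B(1) \<delta>(1) by (simp add: field_simps)
      then show ?thesis using B(2)[OF ab(1)] B(2)[OF ab(2)] \<epsilon> by linarith
    qed
  qed
qed

end

text \<open>By monotone convergence the sum of the series has integral at most the sum of the
  \<open>c n\<close>, so it is finite almost everywhere.\<close>

lemma AE_summable:
  fixes f :: "nat \<Rightarrow> 'a \<Rightarrow> real"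
  assumes f: "\<And>n. integrable N (f n)" "\<And>n \<omega>. \<omega> \<in> space N \<Longrightarrow> 0 \<le> f n \<omega>"
    and c: "\<And>n. (\<integral>\<omega>. f n \<omega> \<partial>N) \<le> c n" "summable c"
  shows "AE \<omega> in N. summable (\<lambda>n. f n \<omega>)"
proof -
  have [measurable]: "f n \<in> borel_measurable N" for n using f(1) by auto
  have c0: "0 \<le> c n" for n
    using c(1)[of n] integral_nonneg_AE[of "f n" N] f(2) by (meson AE_I2 order_trans)
  have "(\<integral>\<^sup>+\<omega>. (\<Sum>n. ennreal (f n \<omega>)) \<partial>N) = (\<Sum>n. \<integral>\<^sup>+\<omega>. ennreal (f n \<omega>) \<partial>N)"
    by (rule nn_integral_suminf) measurable
  also have "\<dots> \<le> (\<Sum>n. ennreal (c n))"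
  proof (rule suminf_le)
    show "(\<integral>\<^sup>+\<omega>. ennreal (f n \<omega>) \<partial>N) \<le> ennreal (c n)" for n
      using nn_integral_eq_integral[OF f(1)[of n]] f(2) c(1)[of n] by (simp add: ennreal_leI)
  qed auto
  also have "\<dots> = ennreal (\<Sum>n. c n)"
    by (rule suminf_ennreal2[OF c0 c(2)])
  finally have "(\<integral>\<^sup>+\<omega>. (\<Sum>n. ennreal (f n \<omega>)) \<partial>N) \<noteq> \<infinity>"
    by (auto simp: top_unique)
  then have "AE \<omega> in N. (\<Sum>n. ennreal (f n \<omega>)) \<noteq> \<infinity>"
    by (intro nn_integral_noteq_infinite) auto
  then show ?thesis
    using AE_space
  proof eventually_elim
    case (elim \<omega>)
    then show ?case
      using f(2) by (intro summable_suminf_not_top) auto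
  qed
qed

text \<open>Here the space itself carries members of the class, so closure under joinings applies to
  them directly, and the limit law is again a measure on the same \<open>X\<close>. The hypothesis
  \<open>close\<close> is all that is used of the pseudometric.\<close>

lemma class_generic_point_limit:
  fixes X :: "'u topology" and xs :: "nat \<Rightarrow> 'u"
  assumes met: "Metric_space (topspace X) d" and top: "Metric_space.mtopology (topspace X) d = X"
    and \<C>: "characteristic_class \<C>" and mem: "\<And>m. (X, \<mu> m, T) \<in> \<C>"
    and xs: "\<And>m. xs m \<in> generic_points X T (\<mu> m)" and x: "x \<in> topspace X"
    and close: "\<And>m. \<forall>\<^sub>F n in sequentially.
        (\<Sum>j<n. d ((T ^^ j) (xs m)) ((T ^^ j) x)) / real n < (1/2) ^ m"
  obtains \<nu> where "(X, \<nu>, T) \<in> \<C>" "x \<in> generic_points X T \<nu>"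
proof -
  interpret Metric_space "topspace X" d by fact
  have sys: "mp_system X (\<mu> m) T" for m
    using characteristic_class_mp_system[OF \<C> mem] .
  note X = mp_systemD[OF sys[of 0]]
  have TX: "T \<in> topspace X \<rightarrow> topspace X"
    using continuous_map_funspace[OF X(4)] by simp
  have haus: "Hausdorff_space X"
    using Hausdorff_space_mtopology top by simp
  have xsX: "xs m \<in> topspace X" for m
    using xs[of m] by (simp add: generic_points_def)
  note orbit = funpow_in_topspace[OF TX]
  define Z where "Z = product_topology (\<lambda>_::nat. X) UNIV"
  define R where "R = prod_map (UNIV :: nat set) (\<lambda>_. T)"
  have ZX: "y n \<in> topspace X" if "y \<in> topspace Z" for y n
    using that by (auto simp: Z_def PiE_iff)
  have R: "R y = (\<lambda>n. T (y n))" for y by (simp add: R_def prod_map_def fun_eq_iff)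
  obtain \<rho> r where join: "is_joining UNIV (\<lambda>_. X) \<mu> (\<lambda>_. T) \<rho>" and r: "strict_mono (r :: nat \<Rightarrow> nat)"
    and lim: "\<And>f. continuous_map (product_topology (\<lambda>_. X) UNIV) euclideanreal f \<Longrightarrow>
        (\<lambda>k. (\<Sum>j<r k. f (\<lambda>i\<in>UNIV. (T ^^ j) (xs i))) / real (r k)) \<longlonglongrightarrow> (\<integral>y. f y \<partial>\<rho>)"
    by (rule generic_points_joining[of UNIV "\<lambda>_. X" \<mu> "\<lambda>_. T" xs, OF countableI_type sys xs]) blast
  have rlim: "filterlim r at_top sequentially"
    by (rule filterlim_subseq[OF r])
  have \<rho>inv: "\<rho> \<in> invariant_measures Z R" and marg: "\<And>m. distr \<rho> (borel_of X) (\<lambda>y. y m) = \<mu> m"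
    using join by (simp_all add: is_joining_def Z_def R_def)
  note \<rho> = invariant_measuresD[OF \<rho>inv]
  interpret \<rho>: prob_space \<rho> by (rule \<rho>(1))
  have m: "measurable \<rho> N = measurable (borel_of Z) N" for N :: "'c measure"
    by (rule measurable_cong_sets[OF \<rho>(2) refl])
  have proj: "continuous_map Z X (\<lambda>y. y n)" for n
    unfolding Z_def by (rule continuous_map_product_projection[where X="\<lambda>_. X"]) simp
  have Zcomp: "compact_space Z"
    unfolding Z_def using X(1) by (simp add: compact_space_product_topology)

  have dcont: "continuous_map Z euclideanreal (\<lambda>y. d (y m) (y n))" for m n
    using continuous_map_mdist_projections[of m UNIV n] unfolding top Z_def by simp
  have dint: "integrable \<rho> (\<lambda>y. d (y m) (y n))" for m n
  proof -
    obtain B where "\<And>y. y \<in> topspace Z \<Longrightarrow> \<bar>d (y m) (y n)\<bar> \<le> B"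
      using continuous_map_bounded_on_compact[OF Zcomp dcont[of m n]] by metis
    then show ?thesis
      using borel_measurable_continuous_map[OF dcont[of m n]]
      by (intro \<rho>.integrable_const_bound[of _ B]) (auto simp: m \<rho>(3))
  qed
  \<comment> \<open>The distance of two coordinates is continuous on the product, so its integral is
    the limit along \<open>r\<close> of the mean distances between the orbits of \<open>xs n\<close>
    and \<open>xs (Suc n)\<close>. Going through the orbit of \<open>x\<close> bounds these by
    (1/2)^n + (1/2)^(n+1).\<close>
  have dsmall: "(\<integral>y. d (y n) (y (Suc n)) \<partial>\<rho>) \<le> 2 * (1/2) ^ n" for n
  proof (rule tendsto_upperbound)
    show "(\<lambda>k. (\<Sum>j<r k. d ((T ^^ j) (xs n)) ((T ^^ j) (xs (Suc n)))) / real (r k)) \<longlonglongrightarrow> (\<integral>y. d (y n) (y (Suc n)) \<partial>\<rho>)"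
      using lim[OF dcont[of n "Suc n", unfolded Z_def]] by simp
    have "\<forall>\<^sub>F N in sequentially. (\<Sum>j<N. d ((T ^^ j) (xs n)) ((T ^^ j) (xs (Suc n)))) / real N \<le> 2 * (1/2) ^ n"
      using close[of n] close[of "Suc n"]
    proof eventually_elim
      case (elim N)
      have "(\<Sum>j<N. d ((T ^^ j) (xs n)) ((T ^^ j) (xs (Suc n)))) \<le>
          (\<Sum>j<N. d ((T ^^ j) (xs n)) ((T ^^ j) x) + d ((T ^^ j) (xs (Suc n))) ((T ^^ j) x))"
        using orbit[OF xsX] orbit[OF x]
        by (intro sum_mono) (metis commute triangle)
      then have "(\<Sum>j<N. d ((T ^^ j) (xs n)) ((T ^^ j) (xs (Suc n)))) / real N \<le>
          (\<Sum>j<N. d ((T ^^ j) (xs n)) ((T ^^ j) x)) / real N +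
          (\<Sum>j<N. d ((T ^^ j) (xs (Suc n))) ((T ^^ j) x)) / real N"
        by (simp add: sum.distrib add_divide_distrib[symmetric] divide_right_mono)
      also have "\<dots> \<le> (1/2) ^ n + (1/2) ^ Suc n"
        using elim by linarith
      also have "\<dots> \<le> 2 * (1/2) ^ n" by simp
      finally show ?case .
    qed
    from eventually_compose_filterlim[OF this rlim]
    show "\<forall>\<^sub>F k in sequentially. (\<Sum>j<r k. d ((T ^^ j) (xs n)) ((T ^^ j) (xs (Suc n)))) / real (r k) \<le> 2 * (1/2) ^ n"
      .
  qed simp

  define \<pi> where "\<pi> = seq_limit X"
  have complete: mcomplete
    using X(1) compact_space_imp_mcomplete by (simp add: top)
  have \<pi>m: "\<pi> \<in> measurable (borel_of Z) (borel_of X)"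
    using measurable_seq_limit[OF complete] unfolding top Z_def \<pi>_def .
  define \<nu> where "\<nu> = distr \<rho> (borel_of X) \<pi>"
  have fac: "is_factor X \<nu> T Z \<rho> R"
    unfolding is_factor_def
  proof (intro bexI[of _ \<pi>] conjI ballI)
    show "\<pi> (R y) = T (\<pi> y)" if "y \<in> topspace Z" for y
      using seq_limit_equivariant[OF haus X(3), of y] ZX[OF that] by (auto simp: \<pi>_def R)
  qed (simp_all add: \<nu>_def \<pi>m)
  have Rcont: "continuous_map Z Z R"
    unfolding Z_def R_def by (rule continuous_map_prod_map) (rule X(4))
  have "\<nu> \<in> invariant_measures X T"
    by (rule invariant_measures_factor[OF \<rho>inv _ _ fac])
      (rule measurable_continuous_map, fact Rcont, rule measurable_continuous_map, fact X(4))
  then have \<nu>sys: "mp_system X \<nu> T"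
    using X by (simp add: mp_system_def)
  have "belongs \<C> Z \<rho> R"
    unfolding Z_def R_def using characteristic_class_joining[OF \<C> mem join] .
  then have \<nu>mem: "(X, \<nu>, T) \<in> \<C>"
    using belongs_factor[OF \<C> _ \<rho>(2) continuous_map_funspace[OF Rcont] \<nu>sys fac] by simp

  have conv: "AE y in \<rho>. limitin X y (\<pi> y) sequentially"
  proof -
    have "AE y in \<rho>. summable (\<lambda>n. d (y n) (y (Suc n)))"
      by (rule AE_summable[OF dint _ dsmall]) (auto simp: summable_geometric)
    then show ?thesis
      using AE_space
    proof eventually_elim
      case (elim y)
      then have "MCauchy y"
        using ZX by (intro MCauchy_if_summable) (auto simp: \<rho>(3))
      then obtain l where "limitin X y l sequentially"
        using complete unfolding mcomplete_def top by blast
      then show ?case using seq_limit_eq[OF haus] by (auto simp: \<pi>_def)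
    qed
  qed
  have "x \<in> generic_points X T \<nu>"
    unfolding generic_points_def
  proof (intro CollectI conjI x allI impI)
    fix f assume f: "continuous_map X euclideanreal f"
    obtain B where B: "\<And>a. a \<in> topspace X \<Longrightarrow> \<bar>f a\<bar> \<le> B"
      using continuous_map_bounded_on_compact[OF X(1) f] by metis
    have fm: "f \<in> borel_measurable (borel_of X)"
      by (rule borel_measurable_continuous_map[OF f])
    have pm: "(\<lambda>y. y n) \<in> measurable \<rho> (borel_of X)" for n
      unfolding m by (rule measurable_continuous_map[OF proj])
    have \<pi>\<rho>: "\<pi> \<in> measurable \<rho> (borel_of X)" using \<pi>m by (simp add: m)
    \<comment> \<open>Almost sure convergence of the coordinates gives convergence of their laws.
      The law of the \<open>n\<close>-th coordinate is \<open>\<mu> n\<close>, so the integrals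
      against \<open>\<mu> n\<close> tend to the integral against \<open>\<nu>\<close>.\<close>
    have "(\<lambda>n. \<integral>y. f (y n) \<partial>\<rho>) \<longlonglongrightarrow> (\<integral>y. f (\<pi> y) \<partial>\<rho>)"
    proof (rule integral_dominated_convergence[where w="\<lambda>_. B"])
      show "(\<lambda>y. f (y n)) \<in> borel_measurable \<rho>" "(\<lambda>y. f (\<pi> y)) \<in> borel_measurable \<rho>" for n
        using measurable_compose[OF pm fm] measurable_compose[OF \<pi>\<rho> fm] by auto
      show "AE y in \<rho>. (\<lambda>n. f (y n)) \<longlonglongrightarrow> f (\<pi> y)"
        using conv by eventually_elim (use continuous_map_limit[OF f] in \<open>fastforce simp: comp_def\<close>)
      show "AE y in \<rho>. norm (f (y n)) \<le> B" for n
        using B ZX by (auto simp: \<rho>(3))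
    qed simp
    moreover have "(\<integral>y. f (y n) \<partial>\<rho>) = (\<integral>a. f a \<partial>\<mu> n)" for n
      using integral_distr[OF pm fm] by (simp add: marg)
    moreover have "(\<integral>y. f (\<pi> y) \<partial>\<rho>) = (\<integral>a. f a \<partial>\<nu>)"
      unfolding \<nu>_def by (rule integral_distr[OF \<pi>\<rho> fm, symmetric])
    ultimately have \<mu>\<nu>: "(\<lambda>n. \<integral>a. f a \<partial>\<mu> n) \<longlonglongrightarrow> (\<integral>a. f a \<partial>\<nu>)" by simp
    show "(\<lambda>n. (\<Sum>j<n. f ((T ^^ j) x)) / real n) \<longlonglongrightarrow> (\<integral>a. f a \<partial>\<nu>)"
    proof (rule tendstoI)
      fix \<epsilon> :: real assume \<epsilon>: "\<epsilon> > 0"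
      \<comment> \<open>Four errors share \<open>\<epsilon>\<close>: the modulus of continuity of
        \<open>f\<close>, its linear term C * (1/2)^p, the genericity of \<open>xs p\<close> for
        \<open>\<mu> p\<close>, and the distance of the integrals against \<open>\<mu> p\<close> and
        \<open>\<nu>\<close>. The index \<open>p\<close> is fixed before the time \<open>n\<close>
        grows.\<close>
      then have "\<epsilon> / 4 > 0" by simp
      have "compact_space mtopology" "continuous_map mtopology euclideanreal f"
        using X(1) f by (simp_all add: top)
      from continuous_map_modulus[OF this \<open>\<epsilon> / 4 > 0\<close>]
      obtain C where C: "C > 0"
        "\<And>a b. a \<in> topspace X \<Longrightarrow> b \<in> topspace X \<Longrightarrow> \<bar>f a - f b\<bar> \<le> \<epsilon> / 4 + C * d a b" by metis
      have "(\<lambda>n. C * (1/2) ^ n) \<longlonglongrightarrow> 0"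
        by (intro tendsto_mult_right_zero LIMSEQ_power_zero) simp
      note order_tendstoD(2)[OF this \<open>\<epsilon> / 4 > 0\<close>]
      moreover note tendstoD[OF \<mu>\<nu> \<open>\<epsilon> / 4 > 0\<close>]
      ultimately have "\<forall>\<^sub>F n in sequentially. C * (1/2) ^ n < \<epsilon> / 4 \<and>
          dist (\<integral>a. f a \<partial>\<mu> n) (\<integral>a. f a \<partial>\<nu>) < \<epsilon> / 4"
        by (rule eventually_conj)
      then obtain p where p: "C * (1/2) ^ p < \<epsilon> / 4" "dist (\<integral>a. f a \<partial>\<mu> p) (\<integral>a. f a \<partial>\<nu>) < \<epsilon> / 4"
        using eventually_happens'[OF sequentially_bot] by blast
      have "(\<lambda>n. (\<Sum>j<n. f ((T ^^ j) (xs p))) / real n) \<longlonglongrightarrow> (\<integral>a. f a \<partial>\<mu> p)"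
        using xs[of p] f by (simp add: generic_points_def)
      from tendstoD[OF this \<open>\<epsilon> / 4 > 0\<close>] close[of p]
      show "\<forall>\<^sub>F n in sequentially. dist ((\<Sum>j<n. f ((T ^^ j) x)) / real n) (\<integral>a. f a \<partial>\<nu>) < \<epsilon>"
      proof eventually_elim
        case (elim n)
        let ?D = "\<Sum>j<n. d ((T ^^ j) (xs p)) ((T ^^ j) x)"
        have "\<bar>(\<Sum>j<n. f ((T ^^ j) (xs p))) - (\<Sum>j<n. f ((T ^^ j) x))\<bar>
            \<le> (\<Sum>j<n. \<bar>f ((T ^^ j) (xs p)) - f ((T ^^ j) x)\<bar>)"
          unfolding sum_subtractf[symmetric] by (rule sum_abs)
        also have "\<dots> \<le> (\<Sum>j<n. \<epsilon> / 4 + C * d ((T ^^ j) (xs p)) ((T ^^ j) x))"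
          by (intro sum_mono C(2) orbit xsX x)
        also have "\<dots> = real n * (\<epsilon> / 4) + C * ?D"
          by (simp add: sum.distrib sum_distrib_left)
        finally have "\<bar>(\<Sum>j<n. f ((T ^^ j) (xs p))) - (\<Sum>j<n. f ((T ^^ j) x))\<bar> / real n
            \<le> (real n * (\<epsilon> / 4) + C * ?D) / real n"
          by (rule divide_right_mono) simp
        \<comment> \<open>An inequality, because for \<open>n = 0\<close> division by zero makes the
          left side 0.\<close>
        also have "\<dots> \<le> \<epsilon> / 4 + C * (?D / real n)"
          using \<epsilon> by (cases "n = 0") (auto simp: field_simps)
        also have "C * (?D / real n) \<le> C * (1/2) ^ p"
          using elim(2) C(1) by (intro mult_left_mono) auto
        finally have "\<bar>(\<Sum>j<n. f ((T ^^ j) (xs p))) / real n - (\<Sum>j<n. f ((T ^^ j) x)) / real n\<bar>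
            \<le> \<epsilon> / 4 + C * (1/2) ^ p"
          by (simp add: diff_divide_distrib[symmetric])
        with elim(1) p show ?case unfolding dist_real_def by linarith
      qed
    qed
  qed
  with \<nu>mem show ?thesis by (rule that)
qed

section \<open>Transport to a homeomorphic copy in the class\<close>

text \<open>With the transported metric \<open>g\<close> is an isometry, so mean distances along
  conjugate orbits are literally the same numbers. It induces the given topology because
  \<open>g\<close> matches the balls of both spaces.\<close>

lemma Metric_space_homeomorphic_image:
  assumes d: "Metric_space (topspace X) d" and top: "Metric_space.mtopology (topspace X) d = X"
    and hg: "homeomorphic_maps X Y h g"
  shows "Metric_space (topspace Y) (\<lambda>a b. d (g a) (g b))"
    and "Metric_space.mtopology (topspace Y) (\<lambda>a b. d (g a) (g b)) = Y"
proof -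
  interpret X: Metric_space "topspace X" d by fact
  have gh: "homeomorphic_maps Y X g h"
    using hg homeomorphic_maps_sym by metis
  have g: "g y \<in> topspace X" "h (g y) = y" if "y \<in> topspace Y" for y
    using hg that by (auto simp: homeomorphic_maps_def continuous_map_def)
  have h: "h z \<in> topspace Y" "g (h z) = z" if "z \<in> topspace X" for z
    using hg that by (auto simp: homeomorphic_maps_def continuous_map_def)
  show met: "Metric_space (topspace Y) (\<lambda>a b. d (g a) (g b))"
  proof
    show "(d (g a) (g b) = 0) = (a = b)" if "a \<in> topspace Y" "b \<in> topspace Y" for a b
      using X.zero[OF g(1)[OF that(1)] g(1)[OF that(2)]] g(2)[OF that(1)] g(2)[OF that(2)] by metis
  qed (auto simp: X.commute intro: X.triangle g(1))
  interpret Y: Metric_space "topspace Y" "\<lambda>a b. d (g a) (g b)" by fact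
  have ball: "Y.mball y e = {z \<in> topspace Y. g z \<in> X.mball (g y) e}" if "y \<in> topspace Y" for y e
    using that g(1) by (auto simp: Y.in_mball X.in_mball)
  have "openin Y.mtopology U \<longleftrightarrow> openin Y U" for U
  proof (cases "U \<subseteq> topspace Y")
    case U: True
    have "openin Y U \<longleftrightarrow> openin X (g ` U)"
      using homeomorphic_map_openness[OF homeomorphic_maps_imp_map[OF gh] U] by simp
    also have "\<dots> \<longleftrightarrow> openin X.mtopology (g ` U)" by (simp add: top)
    also have "\<dots> \<longleftrightarrow> (\<forall>y\<in>U. \<exists>e>0. X.mball (g y) e \<subseteq> g ` U)"
      using U g(1) unfolding X.openin_mtopology by auto
    also have "\<dots> \<longleftrightarrow> (\<forall>y\<in>U. \<exists>e>0. Y.mball y e \<subseteq> U)"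
    proof -
      have "X.mball (g y) e \<subseteq> g ` U \<longleftrightarrow> Y.mball y e \<subseteq> U" if "y \<in> U" for y e
      proof -
        have y: "y \<in> topspace Y" using that U by auto
        show ?thesis
        proof
          assume sub: "X.mball (g y) e \<subseteq> g ` U"
          show "Y.mball y e \<subseteq> U"
          proof
            fix z assume "z \<in> Y.mball y e"
            then have z: "z \<in> topspace Y" "g z \<in> X.mball (g y) e" using ball[OF y] by auto
            then obtain u where "u \<in> U" "g z = g u" using sub by auto
            then show "z \<in> U" using g(2)[OF z(1)] g(2)[of u] U by (metis subsetD)
          qed
        next
          assume sub: "Y.mball y e \<subseteq> U"
          show "X.mball (g y) e \<subseteq> g ` U"
          proof
            fix w assume w: "w \<in> X.mball (g y) e"
            then have wX: "w \<in> topspace X" by (simp add: X.in_mball)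
            then have "h w \<in> Y.mball y e" using w ball[OF y] h by simp
            then show "w \<in> g ` U" using sub h(2)[OF wX] by (metis imageI subsetD)
          qed
        qed
      qed
      then show ?thesis by simp
    qed
    also have "\<dots> \<longleftrightarrow> openin Y.mtopology U"
      using U unfolding Y.openin_mtopology by auto
    finally show ?thesis by simp
  next
    case False
    then show ?thesis
      using openin_subset[of Y U] openin_subset[of Y.mtopology U] by auto
  qed
  then show "Y.mtopology = Y" by (simp add: topology_eq)
qed

theorem corollary3p4:
  fixes X :: "'a topology" and d :: "'a \<Rightarrow> 'a \<Rightarrow> real" and T :: "'a \<Rightarrow> 'a"
    and \<C> :: "'u system set" and xs :: "nat \<Rightarrow> 'a" and x :: 'a
  assumes "Metric_space (topspace X) d"
    and "Metric_space.mtopology (topspace X) d = X"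
    and "compact_space X"
    and "homeomorphic_map X X T"
    and "characteristic_class \<C>"
    and "\<And>m. xs m \<in> class_generic_points X T \<C>"
    and "x \<in> topspace X"
    and "(\<lambda>m. besicovitch d T (xs m) x) \<longlonglongrightarrow> 0"
  shows "x \<in> class_generic_points X T \<C>"
proof -
  note \<C> = assms(5) and x = assms(7)
  have Tc: "continuous_map X X T" by (rule homeomorphic_imp_continuous_map[OF assms(4)])
  have TX: "T \<in> topspace X \<rightarrow> topspace X" by (rule continuous_map_funspace[OF Tc])
  \<comment> \<open>The indices are chosen separately for each \<open>k\<close>. A limsup strictly
    below (1/2)^k bounds the averages themselves from some time on.\<close>
  have "\<exists>m. besicovitch d T (xs m) x < ereal ((1/2) ^ k)" for k
    using eventually_happens[OF order_tendstoD(2)[OF assms(8), of "ereal ((1/2) ^ k)"]] by auto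
  then obtain s where s: "\<And>k. besicovitch d T (xs (s k)) x < ereal ((1/2) ^ k)" by metis
  have close: "\<forall>\<^sub>F n in sequentially.
      (\<Sum>j<n. d ((T ^^ j) (xs (s k))) ((T ^^ j) x)) / real n < (1/2) ^ k" for k
    using Limsup_lessD[OF s[of k, unfolded besicovitch_def]] by simp
  have "\<exists>\<mu>. \<mu> \<in> invariant_measures X T \<and> belongs \<C> X \<mu> T \<and> xs (s k) \<in> generic_points X T \<mu>" for k
    using assms(6)[of "s k"] by (auto simp: class_generic_points_def)
  then obtain \<mu> where \<mu>: "\<And>k. \<mu> k \<in> invariant_measures X T" and bel: "\<And>k. belongs \<C> X (\<mu> k) T"
    and gen: "\<And>k. xs (s k) \<in> generic_points X T (\<mu> k)" by metis
  \<comment> \<open>The copy belonging to index 0 is fixed for all \<open>k\<close>: its space, map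
    and homeomorphism do not involve the measures, so every \<open>\<mu> k\<close> can be pushed to
    \<open>Y\<close> by the same \<open>h\<close>.\<close>
  obtain Y \<omega> S h where Ymem: "(Y, \<omega>, S) \<in> \<C>" and h: "homeomorphic_map X Y h"
    and eq: "\<And>x. x \<in> topspace X \<Longrightarrow> h (T x) = S (h x)"
    using bel[of 0] unfolding belongs_def by blast
  obtain g where hg: "homeomorphic_maps X Y h g" using h homeomorphic_map_maps by blast
  then have hg': "homeomorphic_maps Y X g h" using homeomorphic_maps_sym by metis
  have hc: "continuous_map X Y h" and gc: "continuous_map Y X g"
    and gh: "\<And>z. z \<in> topspace X \<Longrightarrow> g (h z) = z"
    using hg by (auto simp: homeomorphic_maps_def)
  note Y = mp_systemD[OF characteristic_class_mp_system[OF \<C> Ymem]]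
  have SY: "S \<in> topspace Y \<rightarrow> topspace Y" by (rule continuous_map_funspace[OF Y(4)])
  have eq': "g (S y) = T (g y)" if "y \<in> topspace Y" for y
    by (rule homeomorphic_maps_equivariant_inverse[OF hg TX eq that])
  have hX: "h z \<in> topspace Y" if "z \<in> topspace X" for z
    using continuous_map_funspace[OF hc] that by auto
  define \<nu> where "\<nu> k = distr (\<mu> k) (borel_of Y) h" for k
  \<comment> \<open>The copy that witnesses membership of \<open>\<mu> k\<close> may live on another
    space than \<open>Y\<close>, but it has this system as a factor. Closure under factors thus
    collects all indices on one space.\<close>
  have mem: "(Y, \<nu> k, S) \<in> \<C>" for k
  proof -
    have fac: "is_factor Y (\<nu> k) S X (\<mu> k) T"
      unfolding is_factor_def \<nu>_def using measurable_continuous_map[OF hc] eq by blast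
    then have "\<nu> k \<in> invariant_measures Y S"
      by (rule invariant_measures_factor[OF \<mu> measurable_continuous_map[OF Tc] measurable_continuous_map[OF Y(4)]])
    then have "mp_system Y (\<nu> k) S" using Y by (simp add: mp_system_def)
    then show ?thesis
      using belongs_factor[OF \<C> bel invariant_measuresD(2)[OF \<mu>] TX _ fac] by simp
  qed
  have genY: "h (xs (s k)) \<in> generic_points Y S (\<nu> k)" for k
    unfolding \<nu>_def by (rule generic_points_image[OF gen TX hc eq invariant_measuresD(2)[OF \<mu>]])
  have xsX: "xs (s k) \<in> topspace X" for k using gen[of k] by (simp add: generic_points_def)
  have orbit: "(S ^^ j) (h z) = h ((T ^^ j) z)" "g (h ((T ^^ j) z)) = (T ^^ j) z" if "z \<in> topspace X" for j z
    using funpow_equivariant[where S=S and h=h, OF TX eq that] gh[OF funpow_in_topspace[OF TX that]] by auto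
  have closeY: "\<forall>\<^sub>F n in sequentially.
      (\<Sum>j<n. d (g ((S ^^ j) (h (xs (s k))))) (g ((S ^^ j) (h x)))) / real n < (1/2) ^ k" for k
    using close[of k] by (simp add: orbit x xsX)
  obtain \<nu>' where \<nu>': "(Y, \<nu>', S) \<in> \<C>" "h x \<in> generic_points Y S \<nu>'"
    by (rule class_generic_point_limit[OF Metric_space_homeomorphic_image[OF assms(1,2) hg] \<C> mem genY hX[OF x] closeY])
  note \<nu>'inv = mp_systemD(5)[OF characteristic_class_mp_system[OF \<C> \<nu>'(1)]]
  note \<nu>'sets = invariant_measuresD(2)[OF \<nu>'inv]
  \<comment> \<open>The limit law returns to \<open>X\<close> along the inverse of \<open>h\<close>,
    so \<open>h\<close> itself shows that its system belongs to the class.\<close>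
  define \<mu>' where "\<mu>' = distr \<nu>' (borel_of X) g"
  have "is_factor X \<mu>' T Y \<nu>' S"
    unfolding is_factor_def \<mu>'_def using measurable_continuous_map[OF gc] eq' by blast
  then have "\<mu>' \<in> invariant_measures X T"
    by (rule invariant_measures_factor[OF \<nu>'inv measurable_continuous_map[OF Y(4)] measurable_continuous_map[OF Tc]])
  moreover have "belongs \<C> X \<mu>' T"
    unfolding belongs_def
  proof (intro exI conjI ballI)
    show "(Y, \<nu>', S) \<in> \<C>" "homeomorphic_map X Y h" by fact+
    show "distr \<mu>' (borel_of Y) h = \<nu>'"
      unfolding \<mu>'_def by (rule distr_homeomorphic_maps_inverse[OF hg' \<nu>'sets])
  qed (rule eq)
  moreover have "x \<in> generic_points X T \<mu>'"
    using generic_points_image[OF \<nu>'(2) SY gc eq' \<nu>'sets] by (simp add: \<mu>'_def gh x)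
  ultimately show ?thesis
    using x by (auto simp: class_generic_points_def)
qed

end
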